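(* Let $\mu_1,\dots,\mu_d$ be Borel probability measures on $\mathbb{R}^d$ and assume there exist $p_1,\dots,p_d\in(1,+\infty)$ with $\sum_{i=1}^d\frac1{p_i}=1$ and $\sum_{i=1}^d\int_{\mathbb{R}^d}\frac{|x|^{p_i}}{p_i}\,d\mu_i(x)<+\infty$. Consider $$(\mathcal{MK})\quad\sup_{\gamma\in\Pi(\mu_1,\dots,\mu_d)}\int_{(\mathbb{R}^d)^d}\det(x_1,\dots,x_d)\,d\gamma(x_1,\dots,x_d)$$ and $$(\mathcal{D})\quad\inf_{(\phi_1,\dots,\phi_d)\in\mathcal{E}}\sum_{i=1}^d\int_{\mathbb{R}^d}\phi_i\,d\mu_i,$$ where $\mathcal{E}$ is the set of $d$-tuples of lower semicontinuous functions $\phi_i:\mathbb{R}^d\to\mathbb{R}\cup\{+\infty\}$ such that $\sum_{i=1}^d\phi_i(x_i)\ge\det(x_1,\dots,x_d)$ for all $(x_1,\dots,x_d)\in(\mathbb{R}^d)^d$. Then both $(\mathcal{MK})$ and $(\mathcal{D})$ admit solutions and $\max(\mathcal{MK})=\min(\mathcal{D})$. Moreover $(\mathcal{D})$ admits a solution $(\phi_1,\dots,\phi_d)$ such that for all $i=1,\dots,d$ and all $x_i\in\mathbb{R}^d$, $$\phi_i(x_i)=\sup_{(x_j)_{j\ne i}\in(\mathbb{R}^d)^{d-1}}\Bigl\{\det(x_1,\dots,x_d)-\sum_{j\ne i}\phi_j(x_j)\Bigr\}.$$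
   Context: $\det(x_1,\dots,x_d)$ is the determinant of the $d\times d$ matrix with columns $x_1,\dots,x_d\in\mathbb{R}^d$. $\Pi(\mu_1,\dots,\mu_d)$ denotes the set of Borel probability measures $\gamma$ on $(\mathbb{R}^d)^d$ whose $i$-th marginal (push-forward under the $i$-th canonical projection) equals $\mu_i$ for each $i$. *)

theory Defs
  imports "HOL-Probability.Probability"
begin

definition lower_semicontinuous :: "('a::topological_space \<Rightarrow> ereal) \<Rightarrow> bool" where
  "lower_semicontinuous f \<longleftrightarrow> (\<forall>c. open {x. c < f x})"

text \<open>Integral of an extended-real valued function: integral of the positive part
minus integral of the negative part (each in [0,+oo]).  In the pathological case
oo - oo, Isabelle's ereal arithmetic gives +oo.\<close>
definition ereal_integral :: "'a measure \<Rightarrow> ('a \<Rightarrow> ereal) \<Rightarrow> ereal" where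
  "ereal_integral M f =
     enn2ereal (\<integral>\<^sup>+ x. e2ennreal (max 0 (f x)) \<partial>M)
     - enn2ereal (\<integral>\<^sup>+ x. e2ennreal (max 0 (- f x)) \<partial>M)"

definition det_cols :: "real ^ 'd ^ 'd \<Rightarrow> real" where
  "det_cols X = det (transpose X)"

definition couplings :: "('d::finite \<Rightarrow> (real ^ 'd) measure) \<Rightarrow> (real ^ 'd ^ 'd) measure set" where
  "couplings \<mu> = {\<gamma>. prob_space \<gamma> \<and> sets \<gamma> = sets borel \<and>
                     (\<forall>i. distr \<gamma> borel (\<lambda>X. X $ i) = \<mu> i)}"

definition dual_admissible :: "('d::finite \<Rightarrow> real ^ 'd \<Rightarrow> ereal) set" where
  "dual_admissible = {\<phi>. (\<forall>i. lower_semicontinuous (\<phi> i) \<and> (\<forall>x. \<phi> i x \<noteq> -\<infinity>)) \<and>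
                          (\<forall>X::real ^ 'd ^ 'd. (\<Sum>i\<in>UNIV. \<phi> i (X $ i)) \<ge> ereal (det_cols X))}"

definition dual_value :: "('d::finite \<Rightarrow> (real ^ 'd) measure) \<Rightarrow> ('d \<Rightarrow> real ^ 'd \<Rightarrow> ereal) \<Rightarrow> ereal" where
  "dual_value \<mu> \<phi> = (\<Sum>i\<in>UNIV. ereal_integral (\<mu> i) (\<phi> i))"

end

theory Submission
  imports Defs
begin

text \<open>
  The marginals are discretised on a refining sequence of finite partitions of space into boxes. For
  finitely supported marginals, maximising the transport functional plus a small logarithmic barrier
  over the polytope of couplings gives a coupling with positive weights; its first order condition
  produces admissible potentials explicitly, with total slack as small as desired.

  Along a subsequence the weights of all boxes converge. As the marginals are prescribed, the limiting
  weights are those of a coupling \<open>\<gamma>\<close>, and a \<open>\<Gamma>\<close>-limit of the potentials is admissible with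
  slack zero on the support of \<open>\<gamma>\<close>. No uniform integrability enters, since by weak duality a coupling
  and potentials with vanishing slack are both optimal. Conjugating the potentials one coordinate at a
  time lowers them, so the slack stays zero.
\<close>

section \<open>Integrability and weak duality\<close>

text \<open>The determinant is unbounded and changes sign, and a limit of potentials may take the
  value +\<infinity>. Hence no convergence of integrals is attempted; what passes to the limit is a
  pointwise equality on points charged by the limit coupling. The barrier yields potentials because
  at an interior maximiser the gradient \<open>c + \<epsilon> / g\<close> annihilates every signed
  weight with zero marginals, and on a product set this forces it to be a sum of functions of single
  coordinates. The slack at \<open>x\<close> is then \<open>\<epsilon> / g x\<close>, so every atom
  contributes exactly \<epsilon>. Boxes are cut out by half-spaces with rational thresholds and
  coded by binary digits. Level \<open>n\<close> reproduces the marginal masses of all coarser boxes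
  exactly, so no box boundary has to be a null set, as weak convergence would ask. Finite potentials
  are fixed only up to constants with sum zero. They are pinned at an atom of small slack near a
  point charged by the limit coupling, which gives an affine lower bound uniform in the level; hence
  the coupling limit is taken first. The exponents enter through the weighted AM-GM inequality,
  which makes the determinant integrable.\<close>

lemma sum_ereal_neq_MInfty:
  fixes f :: "'i \<Rightarrow> ereal"
  assumes "\<And>i. i \<in> I \<Longrightarrow> f i \<noteq> -\<infinity>"
  shows "sum f I \<noteq> -\<infinity>"
  using assms by (induction I rule: infinite_finite_induct) auto

section \<open>Growth of the determinant, and integrals of extended-real functions\<close>

lemma det_cols_eq_det: "det_cols X = det X"
  by (simp add: det_cols_def det_transpose)

lemma continuous_det_cols: "continuous_on UNIV (det_cols :: real ^ 'd::finite ^ 'd \<Rightarrow> real)"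
  unfolding det_cols_eq_det det_def
  by (intro continuous_intros)

lemma measurable_det_cols [measurable]: "det_cols \<in> borel_measurable borel"
  by (rule borel_measurable_continuous_onI[OF continuous_det_cols])

text \<open>Leibniz expansion with each entry bounded by the norm of its row. Only the product form
  matters later, so the factorial is kept in place of Hadamard's constant.\<close>

lemma abs_det_cols_le:
  fixes X :: "real ^ 'd::finite ^ 'd"
  shows "\<bar>det_cols X\<bar> \<le> fact CARD('d) * (\<Prod>i\<in>UNIV. norm (X $ i))"
proof -
  let ?P = "{\<sigma>. \<sigma> permutes (UNIV :: 'd set)}"
  have "\<bar>det_cols X\<bar> \<le> (\<Sum>\<sigma>\<in>?P. \<bar>of_int (sign \<sigma>) * (\<Prod>i\<in>UNIV. X $ i $ \<sigma> i)\<bar>)"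
    unfolding det_cols_eq_det det_def by (rule sum_abs)
  also have "\<dots> \<le> (\<Sum>\<sigma>\<in>?P. \<Prod>i\<in>UNIV. norm (X $ i))"
  proof (rule sum_mono)
    fix \<sigma> :: "'d \<Rightarrow> 'd"
    have "\<bar>\<Prod>i\<in>UNIV. X $ i $ \<sigma> i\<bar> \<le> (\<Prod>i\<in>UNIV. norm (X $ i))"
      unfolding abs_prod by (rule prod_mono) (auto intro: component_le_norm_cart)
    thus "\<bar>of_int (sign \<sigma>) * (\<Prod>i\<in>UNIV. X $ i $ \<sigma> i)\<bar> \<le> (\<Prod>i\<in>UNIV. norm (X $ i))"
      by (simp add: abs_mult sign_def)
  qed
  also have "\<dots> = fact CARD('d) * (\<Prod>i\<in>UNIV. norm (X $ i))"
    by (simp add: card_permutations[OF refl])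
  finally show ?thesis .
qed

text \<open>Jensen's inequality for \<open>exp\<close> at the points \<open>p i * ln (a i)\<close>
  with weights \<open>1 / p i\<close>. A vanishing factor, where the logarithm says nothing, makes
  the left side zero.\<close>

lemma weighted_am_gm:
  fixes a p :: "'i \<Rightarrow> real"
  assumes "finite I" "I \<noteq> {}" and a: "\<And>i. i \<in> I \<Longrightarrow> a i \<ge> 0"
    and p: "\<And>i. i \<in> I \<Longrightarrow> p i > 0" and sum1: "(\<Sum>i\<in>I. 1 / p i) = 1"
  shows "(\<Prod>i\<in>I. a i) \<le> (\<Sum>i\<in>I. a i powr p i / p i)"
proof (cases "\<exists>i\<in>I. a i = 0")
  case True
  hence "(\<Prod>i\<in>I. a i) = 0" using assms(1) by (simp add: prod_zero)
  thus ?thesis using p by (simp add: sum_nonneg less_imp_le)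
next
  case False
  hence pos: "a i > 0" if "i \<in> I" for i using a[OF that] that by force
  have "(\<Prod>i\<in>I. a i) = exp (\<Sum>i\<in>I. (1 / p i) *\<^sub>R (p i * ln (a i)))"
    unfolding exp_sum[OF assms(1)]
  proof (rule prod.cong[OF refl])
    fix i assume i: "i \<in> I"
    thus "a i = exp ((1 / p i) *\<^sub>R (p i * ln (a i)))" using pos[OF i] p[OF i] by simp
  qed
  also have "\<dots> \<le> (\<Sum>i\<in>I. 1 / p i * exp (p i * ln (a i)))"
    by (rule convex_on_sum[OF assms(1,2) exp_convex sum1]) (use p in \<open>auto intro: less_imp_le\<close>)
  also have "\<dots> = (\<Sum>i\<in>I. a i powr p i / p i)"
    using pos by (intro sum.cong) (auto simp: powr_def less_imp_neq[symmetric])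
  finally show ?thesis .
qed

lemma lower_semicontinuous_borel_measurable:
  assumes "lower_semicontinuous f"
  shows "f \<in> borel_measurable borel"
  using assms by (intro borel_measurableI_greater) (auto simp: lower_semicontinuous_def)

lemma enn2ereal_diff_finite:
  assumes "a < top" "b < top"
  shows "enn2ereal a - enn2ereal b = ereal (enn2real a - enn2real b)"
  using assms by (cases a; cases b) (auto simp: enn2ereal_ennreal)

text \<open>The bound on \<open>f\<close> from below keeps \<open>f\<close> away from the case \<open>\<infinity> - \<infinity>\<close> in
  \<^const>\<open>ereal_integral\<close>.\<close>

lemma ereal_integral_finite:
  fixes f :: "'a \<Rightarrow> ereal"
  assumes [measurable]: "f \<in> borel_measurable M"
    and b: "integrable M b" "\<And>x. ereal (b x) \<le> f x"
    and fin: "(\<integral>\<^sup>+ x. e2ennreal (max 0 (f x)) \<partial>M) < \<infinity>"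
  shows "AE x in M. f x = ereal (real_of_ereal (f x))"
    and "integrable M (\<lambda>x. real_of_ereal (f x))"
    and "ereal_integral M f = ereal (\<integral>x. real_of_ereal (f x) \<partial>M)"
proof -
  let ?g = "\<lambda>x. real_of_ereal (f x)"
  have "AE x in M. e2ennreal (max 0 (f x)) \<noteq> \<infinity>"
    using fin by (intro nn_integral_PInf_AE) auto
  thus ae: "AE x in M. f x = ereal (?g x)"
  proof eventually_elim
    case (elim x)
    show ?case using b(2)[of x] elim by (cases "f x") (auto simp: max_def)
  qed
  have pos: "(\<integral>\<^sup>+ x. ennreal (?g x) \<partial>M) = (\<integral>\<^sup>+ x. e2ennreal (max 0 (f x)) \<partial>M)"
  proof (rule nn_integral_cong_AE)
    show "AE x in M. ennreal (?g x) = e2ennreal (max 0 (f x))"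
      using ae
    proof eventually_elim
      case (elim x)
      then obtain r where "f x = ereal r" by metis
      thus ?case by (simp add: max_def ennreal_neg)
    qed
  qed
  have neg: "(\<integral>\<^sup>+ x. ennreal (- ?g x) \<partial>M) = (\<integral>\<^sup>+ x. e2ennreal (max 0 (- f x)) \<partial>M)"
  proof (rule nn_integral_cong_AE)
    show "AE x in M. ennreal (- ?g x) = e2ennreal (max 0 (- f x))"
      using ae
    proof eventually_elim
      case (elim x)
      then obtain r where "f x = ereal r" by metis
      thus ?case by (simp add: max_def ennreal_neg)
    qed
  qed
  have negfin: "(\<integral>\<^sup>+ x. ennreal (- ?g x) \<partial>M) < \<infinity>"
  proof -
    have "(\<integral>\<^sup>+ x. ennreal (- ?g x) \<partial>M) \<le> (\<integral>\<^sup>+ x. ennreal (norm (b x)) \<partial>M)"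
    proof (rule nn_integral_mono_AE)
      show "AE x in M. ennreal (- ?g x) \<le> ennreal (norm (b x))"
        using ae
      proof eventually_elim
        case (elim x)
        then obtain r where "f x = ereal r" by metis
        thus ?case using b(2)[of x] by (intro ennreal_leI) auto
      qed
    qed
    also have "\<dots> < \<infinity>" using b(1) by (simp add: integrable_iff_bounded)
    finally show ?thesis .
  qed
  show int: "integrable M ?g"
    unfolding real_integrable_def using fin negfin pos by (auto simp: top_unique less_top)
  show "ereal_integral M f = ereal (\<integral>x. ?g x \<partial>M)"
    unfolding ereal_integral_def real_lebesgue_integral_def[OF int] pos[symmetric] neg[symmetric]
    using fin negfin unfolding pos[symmetric] infinity_ennreal_def
    by (intro enn2ereal_diff_finite)
qed

definition subst_row :: "'d \<Rightarrow> 'a \<Rightarrow> 'a ^ 'd \<Rightarrow> 'a ^ 'd" where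
  "subst_row i x X = (\<chi> j. if j = i then x else X $ j)"

lemma subst_row_nth [simp]: "subst_row i x X $ j = (if j = i then x else X $ j)"
  by (simp add: subst_row_def)

text \<open>The determinant grows linearly in a single row. The factors
  \<open>1 + norm (X $ j)\<close> are at least 1, so the one for row \<open>i\<close> can be put
  back and the constant does not depend on \<open>i\<close>.\<close>

lemma abs_det_cols_subst_row_le:
  fixes X :: "real ^ 'd::finite ^ 'd"
  shows "\<bar>det_cols (subst_row i x X)\<bar> \<le> fact CARD('d) * (\<Prod>j\<in>UNIV. 1 + norm (X $ j)) * norm x"
proof -
  have "(\<Prod>j\<in>UNIV. norm (subst_row i x X $ j)) = norm x * (\<Prod>j\<in>UNIV-{i}. norm (X $ j))"
    by (subst prod.remove[of _ i]) auto
  also have "\<dots> \<le> norm x * (\<Prod>j\<in>UNIV-{i}. 1 + norm (X $ j))"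
    by (intro mult_left_mono prod_mono) auto
  also have "\<dots> \<le> norm x * (\<Prod>j\<in>UNIV. 1 + norm (X $ j))"
  proof (rule mult_left_mono)
    have "1 * (\<Prod>j\<in>UNIV-{i}. 1 + norm (X $ j)) \<le> (1 + norm (X $ i)) * (\<Prod>j\<in>UNIV-{i}. 1 + norm (X $ j))"
      by (intro mult_right_mono prod_nonneg) auto
    thus "(\<Prod>j\<in>UNIV-{i}. 1 + norm (X $ j)) \<le> (\<Prod>j\<in>UNIV. 1 + norm (X $ j))"
      by (subst (2) prod.remove[of _ i]) auto
  qed auto
  finally have "fact CARD('d) * (\<Prod>j\<in>UNIV. norm (subst_row i x X $ j)) \<le>
      fact CARD('d) * (norm x * (\<Prod>j\<in>UNIV. 1 + norm (X $ j)))"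
    by (rule mult_left_mono) auto
  hence "fact CARD('d) * (\<Prod>j\<in>UNIV. norm (subst_row i x X $ j)) \<le>
      fact CARD('d) * (\<Prod>j\<in>UNIV. 1 + norm (X $ j)) * norm x"
    by (simp only: mult_ac)
  thus ?thesis using abs_det_cols_le[of "subst_row i x X"] by linarith
qed

text \<open>Freeze all rows but one at \<open>X0\<close>, where the potentials are finite:
  admissibility then bounds the remaining potential from below by a determinant, linear in the free
  row, minus a constant.\<close>

lemma dual_admissible_lower_bound:
  fixes \<phi> :: "'d::finite \<Rightarrow> real ^ 'd \<Rightarrow> ereal"
  assumes adm: "\<phi> \<in> dual_admissible" and X0: "\<And>i. \<phi> i (X0 $ i) < \<infinity>"
  shows "\<exists>A\<ge>0. \<exists>B\<ge>0. \<forall>i x. ereal (- A - B * norm x) \<le> \<phi> i x"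
proof (intro exI conjI allI)
  let ?v = "\<lambda>i. real_of_ereal (\<phi> i (X0 $ i))"
  have v: "\<phi> i (X0 $ i) = ereal (?v i)" for i
    using X0[of i] adm by (cases "\<phi> i (X0 $ i)") (auto simp: dual_admissible_def)
  let ?A = "\<Sum>j\<in>UNIV. \<bar>?v j\<bar>"
  let ?B = "fact CARD('d) * (\<Prod>j\<in>UNIV. 1 + norm (X0 $ j))"
  show "?A \<ge> 0" by (intro sum_nonneg abs_ge_zero)
  show "?B \<ge> 0" by (simp add: prod_nonneg)
  fix i x
  let ?X = "subst_row i x X0"
  have "ereal (det_cols ?X) \<le> (\<Sum>j\<in>UNIV. \<phi> j (?X $ j))"
    using adm unfolding dual_admissible_def by blast
  also have "\<dots> = \<phi> i x + (\<Sum>j\<in>UNIV-{i}. \<phi> j (?X $ j))"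
    by (subst sum.remove[of _ i]) auto
  also have "(\<Sum>j\<in>UNIV-{i}. \<phi> j (?X $ j)) = ereal (\<Sum>j\<in>UNIV-{i}. ?v j)"
    unfolding sum_ereal[symmetric] by (intro sum.cong refl) (simp add: v[symmetric])
  finally have "ereal (det_cols ?X - (\<Sum>j\<in>UNIV-{i}. ?v j)) \<le> \<phi> i x"
    by (cases "\<phi> i x") auto
  moreover have "(\<Sum>j\<in>UNIV-{i}. ?v j) \<le> ?A"
  proof -
    have "(\<Sum>j\<in>UNIV-{i}. ?v j) \<le> (\<Sum>j\<in>UNIV-{i}. \<bar>?v j\<bar>)" by (intro sum_mono abs_ge_self)
    also have "\<dots> \<le> ?A" by (rule sum_mono2) (auto intro: abs_ge_zero simp del: abs_real_of_ereal)
    finally show ?thesis .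
  qed
  hence "- ?A - ?B * norm x \<le> det_cols ?X - (\<Sum>j\<in>UNIV-{i}. ?v j)"
    using abs_det_cols_subst_row_le[of i x X0] by linarith
  ultimately show "ereal (- ?A - ?B * norm x) \<le> \<phi> i x"
    using order_trans ereal_less_eq(3) by blast
qed

section \<open>Weak duality and complementary slackness under the moment hypothesis\<close>

locale determinant_transport =
  fixes \<mu> :: "'d::finite \<Rightarrow> (real ^ 'd) measure" and p :: "'d \<Rightarrow> real"
  assumes prob: "\<And>i. prob_space (\<mu> i)"
    and borel: "\<And>i. sets (\<mu> i) = sets borel"
    and p_gt: "\<And>i. p i > 1"
    and p_sum: "(\<Sum>i\<in>UNIV. 1 / p i) = 1"
    and moments: "(\<Sum>i\<in>UNIV. \<integral>\<^sup>+ x. ennreal (norm x powr p i / p i) \<partial>(\<mu> i)) < \<infinity>"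
begin

lemma measurable_marginal: "measurable (\<mu> i) N = measurable borel N"
  by (rule measurable_cong_sets) (auto simp: borel)

lemma integrable_moment: "integrable (\<mu> i) (\<lambda>x. norm x powr p i / p i)"
proof (rule integrableI_nonneg)
  show "(\<lambda>x. norm x powr p i / p i) \<in> borel_measurable (\<mu> i)"
    unfolding measurable_marginal by measurable
  show "AE x in \<mu> i. 0 \<le> norm x powr p i / p i"
    using p_gt[of i] by auto
  have "(\<integral>\<^sup>+ x. ennreal (norm x powr p i / p i) \<partial>(\<mu> i)) \<le>
      (\<Sum>i\<in>UNIV. \<integral>\<^sup>+ x. ennreal (norm x powr p i / p i) \<partial>(\<mu> i))"
    by (rule member_le_sum) auto
  thus "(\<integral>\<^sup>+ x. ennreal (norm x powr p i / p i) \<partial>(\<mu> i)) < \<infinity>"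
    using moments by simp
qed

lemma integrable_norm_marginal: "integrable (\<mu> i) norm"
proof (rule Bochner_Integration.integrable_bound)
  interpret prob_space "\<mu> i" by (rule prob)
  show "integrable (\<mu> i) (\<lambda>x. 1 + p i * (norm x powr p i / p i))"
    using integrable_moment[of i] by (intro Bochner_Integration.integrable_add integrable_mult_right) auto
  show "norm \<in> borel_measurable (\<mu> i)"
    unfolding measurable_marginal by measurable
  have "norm x \<le> 1 + norm x powr p i" for x :: "real ^ 'd"
  proof (cases "norm x \<le> 1")
    case False
    hence "norm x powr 1 \<le> norm x powr p i"
      using p_gt[of i] by (intro powr_mono) auto
    thus ?thesis using False by simp
  qed (auto simp: add_increasing2)
  thus "AE x in \<mu> i. norm (norm x) \<le> norm (1 + p i * (norm x powr p i / p i))"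
    using p_gt[of i] by (simp add: add_nonneg_nonneg)
qed

text \<open>Functions of this form are the minorants from
  \<open>dual_admissible_lower_bound\<close>; their integrability makes the negative parts of
  potentials integrable.\<close>

lemma integrable_affine_norm: "integrable (\<mu> i) (\<lambda>x. a + b * norm x)"
proof -
  interpret prob_space "\<mu> i" by (rule prob)
  show ?thesis using integrable_norm_marginal[of i] by auto
qed

context
  fixes \<gamma> :: "(real ^ 'd ^ 'd) measure"
  assumes coupling: "\<gamma> \<in> couplings \<mu>"
begin

lemma sets_coupling [simp, measurable_cong]: "sets \<gamma> = sets borel"
  using coupling by (simp add: couplings_def)

lemma prob_space_coupling: "prob_space \<gamma>"
  using coupling by (simp add: couplings_def)

lemma distr_coupling: "distr \<gamma> borel (\<lambda>X. X $ i) = \<mu> i"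
  using coupling by (simp add: couplings_def)

lemma measurable_row_coupling [measurable]: "(\<lambda>X. X $ i) \<in> measurable \<gamma> borel"
  by (subst measurable_cong_sets[OF sets_coupling refl])
     (intro borel_measurable_continuous_onI continuous_intros)

lemma
  assumes "integrable (\<mu> i) f"
  shows integrable_row_coupling: "integrable \<gamma> (\<lambda>X. f (X $ i))"
    and integral_row_coupling: "(\<integral>X. f (X $ i) \<partial>\<gamma>) = (\<integral>x. f x \<partial>\<mu> i :: real)"
proof -
  have f: "f \<in> borel_measurable borel"
    using borel_measurable_integrable[OF assms] by (simp add: measurable_marginal)
  show "integrable \<gamma> (\<lambda>X. f (X $ i))"
    using assms f by (subst integrable_distr_eq[symmetric, where N = borel]) (auto simp: distr_coupling)
  show "(\<integral>X. f (X $ i) \<partial>\<gamma>) = (\<integral>x. f x \<partial>\<mu> i)"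
    using f by (subst integral_distr[symmetric, where N = borel]) (auto simp: distr_coupling)
qed

lemma AE_row_coupling:
  assumes "AE x in \<mu> i. P x"
  shows "AE X in \<gamma>. P (X $ i)"
  using assms unfolding distr_coupling[symmetric, of i] by (rule AE_distrD[rotated]) simp

text \<open>The reciprocals of the exponents sum to 1, so \<open>weighted_am_gm\<close> dominates
  the product of the row norms by a sum of functions of one row each. Their integrals depend on the
  marginals only.\<close>

lemma integrable_det_cols: "integrable \<gamma> det_cols"
proof (rule Bochner_Integration.integrable_bound)
  let ?m = "\<lambda>X. fact CARD('d) * (\<Sum>i\<in>UNIV. norm (X $ i) powr p i / p i)"
  show "integrable \<gamma> ?m"
    by (intro integrable_mult_right Bochner_Integration.integrable_sum
        integrable_row_coupling integrable_moment)
  show "det_cols \<in> borel_measurable \<gamma>" by measurable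
  have "\<bar>det_cols X\<bar> \<le> ?m X" for X :: "real ^ 'd ^ 'd"
  proof -
    have "(\<Prod>i\<in>UNIV. norm (X $ i)) \<le> (\<Sum>i\<in>UNIV. norm (X $ i) powr p i / p i)"
      by (rule weighted_am_gm) (use p_gt p_sum in \<open>auto intro: less_trans[of 0 1]\<close>)
    hence "fact CARD('d) * (\<Prod>i\<in>UNIV. norm (X $ i)) \<le> ?m X"
      by (intro mult_left_mono) auto
    thus ?thesis using abs_det_cols_le[of X] by linarith
  qed
  thus "AE X in \<gamma>. norm (det_cols X) \<le> norm (?m X)"
    by (auto intro: order_trans[OF _ abs_ge_self])
qed

text \<open>Integrate the admissibility inequality. To split the integral, each potential must be
  integrable: a dual value other than \<infinity> forces finite positive parts (an infinite one
  gives \<infinity> even against an infinite negative part), hence a point where all potentials are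
  finite, hence affine minorants.\<close>

lemma weak_duality:
  assumes psi: "\<psi> \<in> dual_admissible"
  shows "ereal (integral\<^sup>L \<gamma> det_cols) \<le> dual_value \<mu> \<psi>"
proof (cases "dual_value \<mu> \<psi> = \<infinity>")
  case False
  have meas: "\<psi> i \<in> borel_measurable (\<mu> i)" for i
    unfolding measurable_marginal
    using psi by (intro lower_semicontinuous_borel_measurable) (auto simp: dual_admissible_def)
  note meas[measurable]
  have posfin: "(\<integral>\<^sup>+ x. e2ennreal (max 0 (\<psi> i x)) \<partial>\<mu> i) < \<infinity>" for i
  proof (rule ccontr)
    assume "\<not> ?thesis"
    hence "(\<integral>\<^sup>+ x. e2ennreal (max 0 (\<psi> i x)) \<partial>\<mu> i) = \<infinity>" by (simp add: less_top[symmetric])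
    hence "ereal_integral (\<mu> i) (\<psi> i) = \<infinity>" by (simp add: ereal_integral_def)
    hence "dual_value \<mu> \<psi> = \<infinity>" unfolding dual_value_def sum_Pinfty by auto
    thus False using False by simp
  qed
  have "\<exists>x. \<psi> i x < \<infinity>" for i
  proof -
    interpret prob_space "\<mu> i" by (rule prob)
    have "AE x in \<mu> i. e2ennreal (max 0 (\<psi> i x)) \<noteq> \<infinity>"
      using posfin[of i] by (intro nn_integral_PInf_AE) auto
    hence "AE x in \<mu> i. \<psi> i x < \<infinity>"
      by eventually_elim (auto simp: max_def split: if_splits)
    thus ?thesis using AE_contr by (metis (mono_tags, lifting) AE_mp AE_I2)
  qed
  then obtain x where x: "\<And>i. \<psi> i (x i) < \<infinity>" by metis
  hence x': "\<psi> i ((\<chi> i. x i) $ i) < \<infinity>" for i by simp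
  obtain A B where lb: "\<And>i x. ereal (- A - B * norm x) \<le> \<psi> i x"
    using dual_admissible_lower_bound[OF psi x'] by blast
  have b: "integrable (\<mu> i) (\<lambda>x. - A - B * norm x)" for i
    using integrable_affine_norm[of i "-A" "-B"] by simp
  note fin = ereal_integral_finite[OF meas b lb posfin]
  let ?g = "\<lambda>i x. real_of_ereal (\<psi> i x)"
  have "integral\<^sup>L \<gamma> det_cols \<le> (\<integral>X. (\<Sum>i\<in>UNIV. ?g i (X $ i)) \<partial>\<gamma>)"
  proof (rule integral_mono_AE)
    show "integrable \<gamma> (\<lambda>X. \<Sum>i\<in>UNIV. ?g i (X $ i))"
      by (intro Bochner_Integration.integrable_sum integrable_row_coupling fin(2))
    have "AE X in \<gamma>. \<forall>i. \<psi> i (X $ i) = ereal (?g i (X $ i))"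
      using AE_row_coupling[OF fin(1)] by (simp add: AE_all_countable)
    thus "AE X in \<gamma>. det_cols X \<le> (\<Sum>i\<in>UNIV. ?g i (X $ i))"
    proof eventually_elim
      case (elim X)
      have "ereal (det_cols X) \<le> (\<Sum>i\<in>UNIV. \<psi> i (X $ i))"
        using psi unfolding dual_admissible_def by blast
      also have "\<dots> = (\<Sum>i\<in>UNIV. ereal (?g i (X $ i)))"
        using elim by (intro sum.cong) auto
      finally show ?case by simp
    qed
  qed (rule integrable_det_cols)
  also have "\<dots> = (\<Sum>i\<in>UNIV. \<integral>x. ?g i x \<partial>\<mu> i)"
    unfolding Bochner_Integration.integral_sum[OF integrable_row_coupling[OF fin(2)]]
      integral_row_coupling[OF fin(2)] ..
  finally show ?thesis by (simp add: dual_value_def fin(3))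
qed simp

text \<open>Integrating the equality requires every potential to be integrable on its own. Almost
  surely \<open>\<phi> i\<close> equals the determinant minus the other potentials, and these have
  affine minorants, so its positive part is bounded by an integrable function of the whole
  family.\<close>

lemma complementary_slackness:
  assumes phi: "\<phi> \<in> dual_admissible"
    and eq: "AE X in \<gamma>. (\<Sum>i\<in>UNIV. \<phi> i (X $ i)) = ereal (det_cols X)"
  shows "dual_value \<mu> \<phi> = ereal (integral\<^sup>L \<gamma> det_cols)"
proof -
  interpret G: prob_space \<gamma> by (rule prob_space_coupling)
  have meas: "\<phi> i \<in> borel_measurable (\<mu> i)" for i
    unfolding measurable_marginal
    using phi by (intro lower_semicontinuous_borel_measurable) (auto simp: dual_admissible_def)
  have meas' [measurable]: "\<phi> i \<in> borel_measurable borel" for i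
    using meas by (simp add: measurable_marginal)
  have finite_val: "\<phi> i (X $ i) < \<infinity>" if "(\<Sum>i\<in>UNIV. \<phi> i (X $ i)) = ereal (det_cols X)" for X i
    using that sum_Pinfty[of "\<lambda>i. \<phi> i (X $ i)" UNIV] by auto
  obtain X0 where X0: "(\<Sum>i\<in>UNIV. \<phi> i (X0 $ i)) = ereal (det_cols X0)"
    using eq G.AE_contr by (metis (mono_tags, lifting) AE_mp AE_I2)
  obtain A B where AB: "A \<ge> 0" "B \<ge> 0" and lb: "\<And>i x. ereal (- A - B * norm x) \<le> \<phi> i x"
    using dual_admissible_lower_bound[OF phi finite_val[OF X0]] by blast
  have b: "integrable (\<mu> i) (\<lambda>x. - A - B * norm x)" for i
    using integrable_affine_norm[of i "-A" "-B"] by simp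
  let ?g = "\<lambda>i x. real_of_ereal (\<phi> i x)"
  have real_val: "\<phi> i (X $ i) = ereal (?g i (X $ i))"
    if "(\<Sum>i\<in>UNIV. \<phi> i (X $ i)) = ereal (det_cols X)" for X i
    using finite_val[OF that, of i] lb[of "X $ i" i] by (cases "\<phi> i (X $ i)") auto
  have sum_val: "(\<Sum>i\<in>UNIV. ?g i (X $ i)) = det_cols X"
    if "(\<Sum>i\<in>UNIV. \<phi> i (X $ i)) = ereal (det_cols X)" for X
  proof -
    have "ereal (\<Sum>i\<in>UNIV. ?g i (X $ i)) = (\<Sum>i\<in>UNIV. \<phi> i (X $ i))"
      unfolding sum_ereal[symmetric] by (intro sum.cong refl real_val[OF that, symmetric])
    thus ?thesis using that by simp
  qed
  let ?h = "\<lambda>X :: real ^ 'd ^ 'd. \<bar>det_cols X\<bar> + (\<Sum>j\<in>UNIV. A + B * norm (X $ j))"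
  have h: "integrable \<gamma> ?h"
    by (intro Bochner_Integration.integrable_add integrable_abs integrable_det_cols
        Bochner_Integration.integrable_sum
        integrable_row_coupling[where f = "\<lambda>x. A + B * norm x"] integrable_affine_norm)
  have posfin: "(\<integral>\<^sup>+ x. e2ennreal (max 0 (\<phi> i x)) \<partial>\<mu> i) < \<infinity>" for i
  proof -
    have "(\<integral>\<^sup>+ x. e2ennreal (max 0 (\<phi> i x)) \<partial>\<mu> i) = (\<integral>\<^sup>+ X. e2ennreal (max 0 (\<phi> i (X $ i))) \<partial>\<gamma>)"
      unfolding distr_coupling[symmetric, of i] by (subst nn_integral_distr) auto
    also have "\<dots> \<le> (\<integral>\<^sup>+ X. ennreal (norm (?h X)) \<partial>\<gamma>)"
    proof (rule nn_integral_mono_AE)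
      show "AE X in \<gamma>. e2ennreal (max 0 (\<phi> i (X $ i))) \<le> ennreal (norm (?h X))"
        using eq
      proof eventually_elim
        case (elim X)
        have low: "- (A + B * norm (X $ j)) \<le> ?g j (X $ j)" for j
          using lb[of "X $ j" j] by (subst (asm) real_val[OF elim]) simp
        have "?g i (X $ i) = det_cols X - (\<Sum>j\<in>UNIV-{i}. ?g j (X $ j))"
          using sum_val[OF elim] sum.remove[of UNIV i "\<lambda>j. ?g j (X $ j)"] by simp
        also have "(\<Sum>j\<in>UNIV-{i}. ?g j (X $ j)) \<ge> (\<Sum>j\<in>UNIV-{i}. - (A + B * norm (X $ j)))"
          by (rule sum_mono) (rule low)
        hence "det_cols X - (\<Sum>j\<in>UNIV-{i}. ?g j (X $ j)) \<le>
            det_cols X + (\<Sum>j\<in>UNIV-{i}. A + B * norm (X $ j))"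
          unfolding sum_negf by linarith
        also have "\<dots> \<le> \<bar>det_cols X\<bar> + (\<Sum>j\<in>UNIV. A + B * norm (X $ j))"
          using AB by (intro add_mono sum_mono2) auto
        finally have "?g i (X $ i) \<le> norm (?h X)" by simp
        hence "max 0 (\<phi> i (X $ i)) \<le> ereal (norm (?h X))"
          by (subst real_val[OF elim]) simp
        hence "e2ennreal (max 0 (\<phi> i (X $ i))) \<le> e2ennreal (ereal (norm (?h X)))"
          by (rule e2ennreal_mono)
        thus ?case by (simp only: e2ennreal_ereal)
      qed
    qed
    also have "\<dots> < \<infinity>" using h by (simp only: integrable_iff_bounded)
    finally show ?thesis .
  qed
  note fin = ereal_integral_finite[OF meas b lb posfin]
  have "dual_value \<mu> \<phi> = ereal (\<Sum>i\<in>UNIV. \<integral>x. ?g i x \<partial>\<mu> i)"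
    by (simp add: dual_value_def fin(3))
  also have "(\<Sum>i\<in>UNIV. \<integral>x. ?g i x \<partial>\<mu> i) = (\<integral>X. (\<Sum>i\<in>UNIV. ?g i (X $ i)) \<partial>\<gamma>)"
    unfolding Bochner_Integration.integral_sum[OF integrable_row_coupling[OF fin(2)]]
      integral_row_coupling[OF fin(2)] ..
  also have "\<dots> = integral\<^sup>L \<gamma> det_cols"
  proof (rule integral_cong_AE)
    show "(\<lambda>X. \<Sum>i\<in>UNIV. ?g i (X $ i)) \<in> borel_measurable \<gamma>" by measurable
    show "det_cols \<in> borel_measurable \<gamma>" by measurable
    show "AE X in \<gamma>. (\<Sum>i\<in>UNIV. ?g i (X $ i)) = det_cols X"
      using eq by eventually_elim (rule sum_val)
  qed
  finally show ?thesis .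
qed

end

end

section \<open>Conjugate potentials\<close>

text \<open>The c-transform for the determinant. Pinning row \<open>i\<close> of a full family to
  \<open>x\<close> stands for letting the other rows range freely and avoids families indexed by the
  remaining coordinates.\<close>

definition conj_potential ::
    "('d::finite \<Rightarrow> real ^ 'd \<Rightarrow> ereal) \<Rightarrow> 'd \<Rightarrow> real ^ 'd \<Rightarrow> ereal" where
  "conj_potential \<phi> i x =
     (SUP X \<in> {X :: real ^ 'd ^ 'd. X $ i = x}. ereal (det_cols X) - (\<Sum>j\<in>UNIV - {i}. \<phi> j (X $ j)))"

lemma conj_potential_le:
  fixes \<phi> :: "'d::finite \<Rightarrow> real ^ 'd \<Rightarrow> ereal"
  assumes adm: "\<phi> \<in> dual_admissible"
  shows "conj_potential \<phi> i x \<le> \<phi> i x"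
  unfolding conj_potential_def
proof (rule SUP_least, clarify)
  fix X :: "real ^ 'd ^ 'd"
  have "ereal (det_cols X) \<le> (\<Sum>j\<in>UNIV. \<phi> j (X $ j))"
    using adm unfolding dual_admissible_def by blast
  also have "\<dots> = \<phi> i (X $ i) + (\<Sum>j\<in>UNIV-{i}. \<phi> j (X $ j))"
    by (subst sum.remove[of _ i]) auto
  finally have "ereal (det_cols X) \<le> \<phi> i (X $ i) + (\<Sum>j\<in>UNIV-{i}. \<phi> j (X $ j))" .
  moreover have "(\<Sum>j\<in>UNIV-{i}. \<phi> j (X $ j)) \<noteq> -\<infinity>"
    using adm by (intro sum_ereal_neq_MInfty) (auto simp: dual_admissible_def)
  ultimately show "ereal (det_cols X) - (\<Sum>j\<in>UNIV-{i}. \<phi> j (X $ j)) \<le> \<phi> i (X $ i)"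
    by (cases "\<Sum>j\<in>UNIV-{i}. \<phi> j (X $ j)"; cases "\<phi> i (X $ i)") auto
qed

text \<open>Via \<open>subst_row\<close> the constraint on row \<open>i\<close> disappears and the
  conjugate is a supremum over all \<open>X\<close> of functions continuous in \<open>x\<close>.
  Where the other potentials sum to \<infinity>, the term is constantly -\<infinity> and its
  superlevel sets are empty.\<close>

lemma lower_semicontinuous_conj_potential:
  fixes \<phi> :: "'d::finite \<Rightarrow> real ^ 'd \<Rightarrow> ereal"
  assumes neq: "\<And>i x. \<phi> i x \<noteq> -\<infinity>"
  shows "lower_semicontinuous (conj_potential \<phi> i)"
  unfolding lower_semicontinuous_def
proof
  fix c
  let ?s = "\<lambda>X. \<Sum>j\<in>UNIV-{i}. \<phi> j (X $ j)"
  have "conj_potential \<phi> i x = (SUP X. ereal (det_cols (subst_row i x X)) - ?s X)" for x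
  proof -
    have "{X. X $ i = x} = range (subst_row i x)"
      by (auto simp: vec_eq_iff image_iff)
    moreover have "?s (subst_row i x X) = ?s X" for X by (intro sum.cong) auto
    ultimately show ?thesis by (simp add: conj_potential_def image_image)
  qed
  hence "{x. c < conj_potential \<phi> i x} = (\<Union>X. {x. c < ereal (det_cols (subst_row i x X)) - ?s X})"
    by (auto simp: less_SUP_iff)
  moreover have "open {x. c < ereal (det_cols (subst_row i x X)) - ?s X}" for X
  proof (cases "?s X")
    case (real r)
    have "continuous_on UNIV (\<lambda>x. det_cols (subst_row i x X))"
    proof (rule continuous_on_compose2[OF continuous_det_cols])
      show "continuous_on UNIV (\<lambda>x. subst_row i x X)"
        unfolding subst_row_def
      proof (rule continuous_on_vec_lambda)
        fix j show "continuous_on UNIV (\<lambda>x. if j = i then x else X $ j)"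
          by (cases "j = i") auto
      qed
    qed auto
    hence "continuous_on UNIV (\<lambda>x. ereal (det_cols (subst_row i x X) - r))"
      by (intro continuous_intros)
    thus ?thesis unfolding real
      by (simp add: open_Collect_less)
  next
    case MInf
    thus ?thesis using sum_ereal_neq_MInfty[of "UNIV-{i}" "\<lambda>j. \<phi> j (X $ j)"] neq by blast
  qed auto
  ultimately show "open {x. c < conj_potential \<phi> i x}" by (auto intro!: open_UN)
qed

text \<open>Being an upper bound in the supremum is admissibility of the new tuple.
  \<open>X0\<close> provides a finite competitor for every \<open>x\<close>, which keeps the
  conjugate away from -\<infinity>.\<close>

lemma dual_admissible_conj_update:
  fixes \<phi> :: "'d::finite \<Rightarrow> real ^ 'd \<Rightarrow> ereal"
  assumes adm: "\<phi> \<in> dual_admissible" and X0: "\<And>j. \<phi> j (X0 $ j) < \<infinity>"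
  shows "\<phi>(i := conj_potential \<phi> i) \<in> dual_admissible"
proof -
  have neq: "\<phi> j x \<noteq> -\<infinity>" for j x using adm by (simp add: dual_admissible_def)
  have lsc: "lower_semicontinuous (\<phi> j)" for j using adm by (simp add: dual_admissible_def)
  have bound: "ereal (det_cols X) - (\<Sum>j\<in>UNIV-{i}. \<phi> j (X $ j)) \<le> conj_potential \<phi> i (X $ i)" for X
    unfolding conj_potential_def by (rule SUP_upper) simp
  have cneq: "conj_potential \<phi> i x \<noteq> -\<infinity>" for x
  proof -
    let ?X = "subst_row i x X0"
    have "(\<Sum>j\<in>UNIV-{i}. \<phi> j (?X $ j)) \<noteq> \<infinity>"
      using X0 by (auto simp: sum_Pinfty)
    moreover have "(\<Sum>j\<in>UNIV-{i}. \<phi> j (?X $ j)) \<noteq> -\<infinity>"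
      by (intro sum_ereal_neq_MInfty neq)
    ultimately show ?thesis
      using bound[of ?X] by (cases "\<Sum>j\<in>UNIV-{i}. \<phi> j (?X $ j)") auto
  qed
  have "ereal (det_cols X) \<le> (\<Sum>j\<in>UNIV. (\<phi>(i := conj_potential \<phi> i)) j (X $ j))" for X
  proof -
    have "(\<Sum>j\<in>UNIV. (\<phi>(i := conj_potential \<phi> i)) j (X $ j)) =
        conj_potential \<phi> i (X $ i) + (\<Sum>j\<in>UNIV-{i}. \<phi> j (X $ j))"
      by (subst sum.remove[of _ i]) auto
    moreover have "(\<Sum>j\<in>UNIV-{i}. \<phi> j (X $ j)) \<noteq> -\<infinity>"
      by (intro sum_ereal_neq_MInfty neq)
    ultimately show ?thesis
      using bound[of X] cneq[of "X $ i"]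
      by (cases "\<Sum>j\<in>UNIV-{i}. \<phi> j (X $ j)"; cases "conj_potential \<phi> i (X $ i)") auto
  qed
  thus ?thesis
    using neq cneq lsc lower_semicontinuous_conj_potential[of \<phi> i]
    by (auto simp: dual_admissible_def)
qed

lemma conj_potential_antimono:
  assumes "\<And>j x. \<psi> j x \<le> \<phi> j x"
  shows "conj_potential \<phi> i x \<le> conj_potential \<psi> i x"
  unfolding conj_potential_def
  by (intro SUP_mono' ereal_minus_mono sum_mono assms order_refl)

text \<open>Replacing one potential by its conjugate lowers it, hence raises the conjugates of the others;
  since these are bounded by the potentials anyway, coordinates that were already conjugate stay so.\<close>

lemma ex_conjugate_potentials:
  fixes \<phi> :: "'d::finite \<Rightarrow> real ^ 'd \<Rightarrow> ereal"
  assumes adm: "\<phi> \<in> dual_admissible" and X0: "\<And>j. \<phi> j (X0 $ j) < \<infinity>"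
  shows "\<exists>\<psi>\<in>dual_admissible. (\<forall>i x. \<psi> i x \<le> \<phi> i x) \<and> (\<forall>i. \<psi> i = conj_potential \<psi> i)"
proof -
  have "\<exists>\<psi>\<in>dual_admissible. (\<forall>i x. \<psi> i x \<le> \<phi> i x) \<and> (\<forall>i\<in>A. \<psi> i = conj_potential \<psi> i)"
    if "finite A" for A
    using that
  proof (induction A)
    case empty
    show ?case using adm by auto
  next
    case (insert k A)
    then obtain \<psi> where psi: "\<psi> \<in> dual_admissible" "\<And>i x. \<psi> i x \<le> \<phi> i x"
      "\<And>i. i \<in> A \<Longrightarrow> \<psi> i = conj_potential \<psi> i" by blast
    let ?\<psi> = "\<psi>(k := conj_potential \<psi> k)"
    have adm': "?\<psi> \<in> dual_admissible"
      using le_less_trans[OF psi(2) X0] by (rule dual_admissible_conj_update[OF psi(1)])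
    have le: "?\<psi> i x \<le> \<psi> i x" for i x using conj_potential_le[OF psi(1)] by simp
    have conj: "?\<psi> i = conj_potential ?\<psi> i" if i: "i \<in> insert k A" for i
    proof (cases "i = k")
      case True
      \<comment> \<open>The conjugate in coordinate \<open>k\<close> only involves the potentials of
        the other coordinates.\<close>
      have "conj_potential ?\<psi> k = conj_potential \<psi> k"
        unfolding conj_potential_def by (intro ext SUP_cong refl arg_cong2[where f = minus] sum.cong) auto
      thus ?thesis using True by simp
    next
      case False
      hence "?\<psi> i x = conj_potential \<psi> i x" for x
        using psi(3)[of i] i by simp
      hence "?\<psi> i x \<le> conj_potential ?\<psi> i x" for x
        using conj_potential_antimono[of ?\<psi> \<psi> i x] le by simp
      thus ?thesis using conj_potential_le[OF adm'] by (intro ext antisym)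
    qed
    show ?case
    proof (intro bexI[OF _ adm'] conjI allI ballI)
      show "?\<psi> i x \<le> \<phi> i x" for i x by (rule order_trans[OF le psi(2)])
    qed (rule conj)
  qed
  from this[of UNIV] show ?thesis by simp
qed

section \<open>Approximate duality for finitely supported marginals\<close>

text \<open>Tychonoff's theorem for the topology of the function type. The weights below are
  functions on all of \<open>'d \<Rightarrow> 'a\<close>, possibly infinitely many
  coordinates.\<close>

lemma compact_Pi_UNIV:
  fixes A :: "'i \<Rightarrow> 'b::topological_space set"
  assumes "\<And>i. compact (A i)"
  shows "compact (PiE UNIV A)"
proof -
  have "compactin (product_topology (\<lambda>_. euclidean) UNIV) (PiE UNIV A)"
    using assms by (simp add: compactin_PiE)
  thus ?thesis by (simp add: euclidean_product_topology)
qed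

text \<open>The barrier makes any weights that do at least as well as the product coupling stay
  above an explicit threshold. Maximising over weights above a smaller threshold \<eta> keeps
  \<open>ln\<close> continuous, and the maximiser strictly exceeds \<eta>, so small variations of it
  remain competitors.\<close>

lemma finite_log_barrier_maximizer:
  fixes S :: "'d::finite \<Rightarrow> 'a set" and m :: "'d \<Rightarrow> 'a \<Rightarrow> real" and c :: "('d \<Rightarrow> 'a) \<Rightarrow> real"
  assumes fin: "\<And>i. finite (S i)"
    and pos: "\<And>i a. a \<in> S i \<Longrightarrow> m i a > 0"
    and sum1: "\<And>i. (\<Sum>a\<in>S i. m i a) = 1"
    and eps: "\<epsilon> > 0"
  defines "F \<equiv> PiE UNIV S"
  defines "J \<equiv> \<lambda>g. (\<Sum>x\<in>F. c x * g x + \<epsilon> * ln (g x))"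
  defines "T \<equiv> {g. (\<forall>i. \<forall>a\<in>S i. (\<Sum>x\<in>{x\<in>F. x i = a}. g x) = m i a)}"
  shows "\<exists>g\<in>T. \<exists>\<eta>>0. (\<forall>x\<in>F. g x > \<eta>) \<and> (\<forall>h\<in>T. (\<forall>x\<in>F. h x \<ge> \<eta>) \<longrightarrow> J h \<le> J g)"
proof -
  have finF: "finite F"
    unfolding F_def by (intro finite_PiE fin) auto
  have le1: "g x \<le> 1" if g: "g \<in> T" "\<And>x. x \<in> F \<Longrightarrow> g x \<ge> 0" and x: "x \<in> F" for g x
  proof -
    define i :: 'd where "i = undefined"
    have xi: "x i \<in> S i" using x by (auto simp: F_def)
    have "g x \<le> (\<Sum>y\<in>{y\<in>F. y i = x i}. g y)"
      by (rule member_le_sum) (use x g finF in auto)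
    also have "\<dots> = m i (x i)" using g xi by (auto simp: T_def)
    also have "\<dots> \<le> (\<Sum>a\<in>S i. m i a)"
      by (rule member_le_sum) (use xi fin pos in \<open>auto intro: less_imp_le\<close>)
    finally show ?thesis using sum1 by simp
  qed
  \<comment> \<open>The product coupling, feasible because the masses of the other coordinates sum
    to 1; its value is the benchmark for the threshold.\<close>
  define q where "q = (\<lambda>x. \<Prod>i\<in>UNIV. m i (x i))"
  have qpos: "q x > 0" if "x \<in> F" for x
    unfolding q_def using that pos by (intro prod_pos) (auto simp: F_def)
  have qT: "q \<in> T"
  proof -
    have "(\<Sum>x\<in>{x\<in>F. x i = a}. q x) = m i a" if a: "a \<in> S i" for i a
    proof -
      have "{x\<in>F. x i = a} = PiE UNIV (S(i := {a}))"
        using a by (auto simp: F_def PiE_iff split: if_splits)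
      hence "(\<Sum>x\<in>{x\<in>F. x i = a}. q x) = (\<Prod>j\<in>UNIV. \<Sum>b\<in>(S(i := {a})) j. m j b)"
        unfolding q_def by (subst prod_sum_PiE) (use fin in auto)
      also have "\<dots> = (\<Sum>b\<in>{a}. m i b) * (\<Prod>j\<in>UNIV-{i}. \<Sum>b\<in>S j. m j b)"
        by (subst prod.remove[of _ i]) auto
      finally show ?thesis using sum1 by simp
    qed
    thus ?thesis by (simp add: T_def)
  qed
  define C where "C = (\<Sum>x\<in>F. \<bar>c x\<bar>)"
  \<comment> \<open>Weights are at most 1, so all logarithms are nonpositive and
    \<open>J g \<le> C + \<epsilon> * ln (g x)\<close> for each single \<open>x\<close>. Solving
    this together with \<open>J q \<le> J g\<close> for \<open>g x\<close> gives the
    threshold.\<close>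
  define \<eta>' where "\<eta>' = exp ((J q - C) / \<epsilon>)"
  have lower: "g x \<ge> \<eta>'" if g: "g \<in> T" "\<And>x. x \<in> F \<Longrightarrow> g x > 0" "J g \<ge> J q" and x: "x \<in> F" for g x
  proof -
    have g1: "g y \<le> 1" if "y \<in> F" for y
      using le1[OF g(1) _ that] g(2) by (auto intro: less_imp_le)
    have "J g = (\<Sum>x\<in>F. c x * g x) + \<epsilon> * (\<Sum>x\<in>F. ln (g x))"
      by (simp add: J_def sum.distrib sum_distrib_left)
    moreover have "(\<Sum>x\<in>F. c x * g x) \<le> C"
      unfolding C_def
    proof (rule sum_mono)
      fix y assume y: "y \<in> F"
      have "c y * g y \<le> \<bar>c y\<bar> * g y"
        using g(2)[OF y] by (intro mult_right_mono) auto
      also have "\<dots> \<le> \<bar>c y\<bar> * 1"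
        using g1[OF y] by (intro mult_left_mono) auto
      finally show "c y * g y \<le> \<bar>c y\<bar>" by simp
    qed
    moreover have "(\<Sum>y\<in>F. ln (g y)) \<le> ln (g x)"
    proof -
      have "(\<Sum>y\<in>F. ln (g y)) = ln (g x) + (\<Sum>y\<in>F-{x}. ln (g y))"
        using x finF by (rule sum.remove[rotated])
      moreover have "(\<Sum>y\<in>F-{x}. ln (g y)) \<le> 0"
        using g1 g(2) by (intro sum_nonpos) auto
      ultimately show ?thesis by simp
    qed
    hence "\<epsilon> * (\<Sum>y\<in>F. ln (g y)) \<le> \<epsilon> * ln (g x)"
      using eps by simp
    ultimately have "J q - C \<le> \<epsilon> * ln (g x)" using g(3) by linarith
    hence "(J q - C) / \<epsilon> \<le> ln (g x)"
      using eps by (simp add: field_simps)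
    hence "\<eta>' \<le> exp (ln (g x))" unfolding \<eta>'_def by simp
    thus ?thesis using g(2)[OF x] by simp
  qed
  \<comment> \<open>Any number strictly between 0 and \<open>\<eta>'\<close> would do; the strict
    gap is the room for variations.\<close>
  define \<eta> where "\<eta> = \<eta>' / 2"
  have eta: "\<eta> > 0" "\<eta> < \<eta>'" by (auto simp: \<eta>_def \<eta>'_def)
  \<comment> \<open>Outside the finite set \<open>F\<close> weights are set to 0, which makes this
    box a product of compact sets and does not affect \<open>J\<close> or the constraints.\<close>
  define B where "B = PiE UNIV (\<lambda>x. if x \<in> F then {\<eta>..1} else {0})"
  define K where "K = B \<inter> T"
  have compB: "compact B"
    unfolding B_def by (rule compact_Pi_UNIV) auto
  have closedT: "closed T"
  proof -
    have "T = (\<Inter>i. \<Inter>a\<in>S i. {g. (\<Sum>x\<in>{x\<in>F. x i = a}. g x) = m i a})"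
      by (auto simp: T_def)
    moreover have "closed {g. (\<Sum>x\<in>{x\<in>F. x i = a}. g x) = m i a}" for i a
      by (intro closed_Collect_eq continuous_intros continuous_on_product_coordinates)
    ultimately show ?thesis by auto
  qed
  have compK: "compact K"
    unfolding K_def using compB closedT by (rule compact_Int_closed)
  have restr: "(\<lambda>x. if x \<in> F then h x else 0) \<in> K"
    if h: "h \<in> T" "\<And>x. x \<in> F \<Longrightarrow> h x \<ge> \<eta>" for h
  proof -
    have "h x \<le> 1" if "x \<in> F" for x
      using le1[OF h(1) _ that] h(2) eta(1) by (meson less_imp_le order_trans)
    thus ?thesis using h by (auto simp: K_def B_def T_def)
  qed
  have qlow: "q x \<ge> \<eta>" if "x \<in> F" for x
    using lower[OF qT qpos order_refl that] eta by simp
  define q' where "q' = (\<lambda>x. if x \<in> F then q x else 0)"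
  have q'K: "q' \<in> K" unfolding q'_def by (rule restr[OF qT qlow])
  have contJ: "continuous_on K J"
    unfolding J_def
  proof (intro continuous_intros)
    fix x assume x: "x \<in> F"
    show "continuous_on K (\<lambda>g. g x)"
      by (rule continuous_on_subset[OF continuous_on_product_coordinates]) auto
    show "continuous_on K (\<lambda>g. g x)"
      by (rule continuous_on_subset[OF continuous_on_product_coordinates]) auto
    show "\<forall>g\<in>K. g x \<noteq> 0"
    proof
      fix g assume "g \<in> K"
      hence "g x \<in> (if x \<in> F then {\<eta>..1} else {0})" by (auto simp: K_def B_def PiE_iff)
      thus "g x \<noteq> 0" using x eta(1) by simp
    qed
  qed
  obtain g where g: "g \<in> K" "\<And>h. h \<in> K \<Longrightarrow> J h \<le> J g"
    using continuous_attains_sup[OF compK _ contJ] q'K by blast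
  have gT: "g \<in> T" using g(1) by (simp add: K_def)
  have glow: "g x \<ge> \<eta>" if "x \<in> F" for x
  proof -
    have "g x \<in> (if x \<in> F then {\<eta>..1} else {0})" using g(1) by (auto simp: K_def B_def PiE_iff)
    thus ?thesis using that by simp
  qed
  have "J q' = J q" by (simp add: J_def q'_def)
  hence "J q \<le> J g" using g(2)[OF q'K] by simp
  hence glow': "g x > \<eta>" if "x \<in> F" for x
    using lower[OF gT _ _ that] glow eta by (meson order.strict_trans2)
  have "J h \<le> J g" if h: "h \<in> T" "\<forall>x\<in>F. h x \<ge> \<eta>" for h
  proof -
    have "J (\<lambda>x. if x \<in> F then h x else 0) = J h" by (simp add: J_def)
    thus "J h \<le> J g" using g(2)[OF restr[OF h(1)]] h(2) by simp
  qed
  thus ?thesis using gT eta(1) glow' by blast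
qed

text \<open>The gradient \<open>G\<close> at the maximiser is orthogonal to all weights with zero
  marginals and therefore splits into potentials of single coordinates. It exceeds \<open>c\<close>
  by \<open>\<epsilon> / g x\<close>, which gives admissibility and total slack
  \<open>\<epsilon> * card F\<close>.\<close>

lemma finite_duality:
  fixes S :: "'d::finite \<Rightarrow> 'a set" and m :: "'d \<Rightarrow> 'a \<Rightarrow> real" and c :: "('d \<Rightarrow> 'a) \<Rightarrow> real"
  assumes fin: "\<And>i. finite (S i)"
    and pos: "\<And>i a. a \<in> S i \<Longrightarrow> m i a > 0"
    and sum1: "\<And>i. (\<Sum>a\<in>S i. m i a) = 1"
    and e: "e > 0"
  defines "F \<equiv> PiE UNIV S"
  shows "\<exists>g \<phi>. (\<forall>x\<in>F. g x > 0) \<and>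
    (\<forall>i. \<forall>a\<in>S i. (\<Sum>x\<in>{x\<in>F. x i = a}. g x) = m i a) \<and>
    (\<forall>x\<in>F. c x \<le> (\<Sum>i\<in>UNIV. \<phi> i (x i))) \<and>
    (\<Sum>x\<in>F. g x * ((\<Sum>i\<in>UNIV. \<phi> i (x i)) - c x)) \<le> e"
proof -
  have finF: "finite F"
    unfolding F_def by (intro finite_PiE fin) auto
  \<comment> \<open>Chosen so that \<open>\<epsilon> * card F \<le> e\<close>; the added 1 avoids a
    division by zero.\<close>
  define \<epsilon> where "\<epsilon> = e / (1 + card F)"
  have eps: "\<epsilon> > 0" using e by (simp add: \<epsilon>_def)
  define J where "J = (\<lambda>g. (\<Sum>x\<in>F. c x * g x + \<epsilon> * ln (g x)))"
  define T where "T = {g. (\<forall>i. \<forall>a\<in>S i. (\<Sum>x\<in>{x\<in>F. x i = a}. g x) = m i a)}"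
  have "\<exists>g\<in>T. \<exists>\<eta>>0. (\<forall>x\<in>F. g x > \<eta>) \<and> (\<forall>h\<in>T. (\<forall>x\<in>F. h x \<ge> \<eta>) \<longrightarrow> J h \<le> J g)"
    using finite_log_barrier_maximizer[where S = S and m = m and c = c and \<epsilon> = \<epsilon>, OF fin pos sum1 eps]
    unfolding F_def[symmetric] T_def[symmetric] J_def by simp
  then obtain g \<eta> where g: "\<eta> > 0" "g \<in> T" "\<And>x. x \<in> F \<Longrightarrow> g x > \<eta>"
    "\<And>h. h \<in> T \<Longrightarrow> \<forall>x\<in>F. h x \<ge> \<eta> \<Longrightarrow> J h \<le> J g"
    by blast
  have gpos: "g x > 0" if "x \<in> F" for x using g(1) g(3)[OF that] by simp
  define G where "G = (\<lambda>x. c x + \<epsilon> / g x)"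
  have first_order: "(\<Sum>x\<in>F. G x * h x) = 0"
    if h: "\<And>i a. a \<in> S i \<Longrightarrow> (\<Sum>x\<in>{x\<in>F. x i = a}. h x) = 0" for h
  proof -
    define H where "H = 1 + (\<Sum>x\<in>F. \<bar>h x\<bar>)"
    have Hpos: "H > 0" unfolding H_def by (simp add: add_pos_nonneg sum_nonneg)
    have hH: "\<bar>h x\<bar> \<le> H" if "x \<in> F" for x
      using member_le_sum[OF that, of "\<lambda>x. \<bar>h x\<bar>"] finF by (auto simp: H_def)
    \<comment> \<open>The margin above \<eta>. For times below \<open>gap / H\<close> the varied
      weights stay above \<eta>; the inserted 1 keeps \<open>Min\<close> meaningful before
      \<open>F\<close> is known to be nonempty.\<close>
    define gap where "gap = Min (insert 1 ((\<lambda>x. g x - \<eta>) ` F))"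
    have gap: "gap > 0" "\<And>x. x \<in> F \<Longrightarrow> gap \<le> g x - \<eta>"
      using g(3) finF by (auto simp: gap_def)
    define f where "f = (\<lambda>t. J (\<lambda>x. g x + t * h x))"
    have "(f has_real_derivative (\<Sum>x\<in>F. G x * h x)) (at 0)"
    proof -
      have "((\<lambda>t. \<Sum>x\<in>F. c x * (g x + t * h x) + \<epsilon> * ln (g x + t * h x)) has_real_derivative
             (\<Sum>x\<in>F. G x * h x)) (at 0)"
      proof (rule DERIV_sum)
        fix x assume x: "x \<in> F"
        show "((\<lambda>t. c x * (g x + t * h x) + \<epsilon> * ln (g x + t * h x)) has_real_derivative G x * h x) (at 0)"
          using gpos[OF x] by (auto intro!: derivative_eq_intros simp: G_def field_simps)
      qed
      thus ?thesis by (simp add: f_def J_def)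
    qed
    moreover have "gap / H > 0" using gap Hpos by simp
    moreover have "\<forall>t. \<bar>0 - t\<bar> < gap / H \<longrightarrow> f t \<le> f 0"
    proof (intro allI impI)
      fix t :: real assume t: "\<bar>0 - t\<bar> < gap / H"
      have "J (\<lambda>x. g x + t * h x) \<le> J g"
      proof (rule g(4))
        show "(\<lambda>x. g x + t * h x) \<in> T"
          using g(2) h by (simp add: T_def sum.distrib flip: sum_distrib_left)
        show "\<forall>x\<in>F. \<eta> \<le> g x + t * h x"
        proof
          fix x assume x: "x \<in> F"
          have "\<bar>t * h x\<bar> \<le> gap / H * H"
            unfolding abs_mult using t hH[OF x] Hpos gap(1) by (intro mult_mono) auto
          also have "\<dots> = gap" using Hpos by simp
          finally show "\<eta> \<le> g x + t * h x" using gap(2)[OF x] by simp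
        qed
      qed
      thus "f t \<le> f 0" by (simp add: f_def)
    qed
    ultimately show ?thesis by (rule DERIV_local_max)
  qed
  have "S i \<noteq> {}" for i using sum1[of i] by auto
  hence "F \<noteq> {}" by (simp add: F_def PiE_eq_empty_iff)
  then obtain x0 where x0: "x0 \<in> F" by blast
  have upd: "x0(i := x i) \<in> F" if "x \<in> F" for x i
    using that x0 by (auto simp: F_def PiE_iff)
  define N where "N = real CARD('d)"
  have Npos: "N > 0" by (simp add: N_def)
  \<comment> \<open>Read off from \<open>G x = (\<Sum>i. G (x0(i := x i))) - (N - 1) * G x0\<close>,
    the constant being shared equally among the \<open>N\<close> coordinates.\<close>
  define \<phi> where "\<phi> = (\<lambda>i a. G (x0(i := a)) - (N - 1) / N * G x0)"
  define \<delta> where "\<delta> = (\<lambda>z y :: 'd \<Rightarrow> 'a. of_bool (y = z) :: real)"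
  have delta: "(\<Sum>y\<in>A. u y * \<delta> z y) = of_bool (z \<in> A) * u z" if "finite A" for A u z
    using that by (simp add: \<delta>_def of_bool_def if_distrib cong: if_cong)
  have Gx: "G x = (\<Sum>i\<in>UNIV. \<phi> i (x i))" if x: "x \<in> F" for x
  proof -
    \<comment> \<open>This signed measure has vanishing marginals, and pairing it with \<open>G\<close> expresses \<open>G x\<close>
        by values of \<open>G\<close> at points that differ from \<open>x0\<close> in one coordinate only.\<close>
    define h where "h = (\<lambda>y. \<delta> x y + (N - 1) * \<delta> x0 y - (\<Sum>i\<in>UNIV. \<delta> (x0(i := x i)) y))"
    have pair: "(\<Sum>y\<in>A. u y * h y) = of_bool (x \<in> A) * u x + (N - 1) * (of_bool (x0 \<in> A) * u x0)
        - (\<Sum>i\<in>UNIV. of_bool (x0(i := x i) \<in> A) * u (x0(i := x i)))" if "finite A" for A u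
    proof -
      have "(\<Sum>y\<in>A. u y * h y) = (\<Sum>y\<in>A. u y * \<delta> x y) + (N - 1) * (\<Sum>y\<in>A. u y * \<delta> x0 y)
        - (\<Sum>y\<in>A. \<Sum>i\<in>UNIV. u y * \<delta> (x0(i := x i)) y)"
        by (simp add: h_def algebra_simps sum.distrib sum_subtractf sum_distrib_left)
      also have "(\<Sum>y\<in>A. \<Sum>i\<in>UNIV. u y * \<delta> (x0(i := x i)) y)
          = (\<Sum>i\<in>UNIV. \<Sum>y\<in>A. u y * \<delta> (x0(i := x i)) y)"
        by (rule sum.swap)
      finally show ?thesis by (simp only: delta[OF that])
    qed
    have "(\<Sum>y\<in>{y\<in>F. y j = a}. h y) = 0" for j a
    proof -
      have "(\<Sum>y\<in>{y\<in>F. y j = a}. h y) = of_bool (x j = a) + (N - 1) * of_bool (x0 j = a)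
        - (\<Sum>i\<in>UNIV. of_bool ((x0(i := x i)) j = a))"
        using pair[of "{y\<in>F. y j = a}" "\<lambda>_. 1"] finF x x0 upd by (simp add: mult.commute)
      \<comment> \<open>In coordinate \<open>j\<close> only the summand \<open>i = j\<close> sees
        \<open>x j\<close>; the other \<open>N - 1\<close> see \<open>x0 j\<close> and cancel the
        multiple of \<delta> at \<open>x0\<close>.\<close>
      also have "(\<Sum>i\<in>UNIV. of_bool ((x0(i := x i)) j = a)) =
          of_bool (x j = a) + (\<Sum>i\<in>UNIV-{j}. of_bool (x0 j = a) :: real)"
        by (subst sum.remove[of _ j]) (auto intro!: sum.cong)
      also have "(\<Sum>i\<in>UNIV-{j}. of_bool (x0 j = a) :: real) = (N - 1) * of_bool (x0 j = a)"
        by (simp add: N_def card_Diff_singleton of_nat_diff)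
      finally show ?thesis by simp
    qed
    hence "(\<Sum>y\<in>F. G y * h y) = 0" by (intro first_order)
    hence "G x = (\<Sum>i\<in>UNIV. G (x0(i := x i))) - (N - 1) * G x0"
      using pair[OF finF, of G] x x0 upd by simp
    also have "\<dots> = (\<Sum>i\<in>UNIV. \<phi> i (x i))"
      using Npos by (simp add: \<phi>_def sum_subtractf N_def[symmetric])
    finally show ?thesis .
  qed
  show ?thesis
  proof (intro exI[of _ g] exI[of _ \<phi>] conjI ballI allI)
    show "g x > 0" if "x \<in> F" for x by (rule gpos[OF that])
    show "(\<Sum>x\<in>{x\<in>F. x i = a}. g x) = m i a" if "a \<in> S i" for i a
      using g(2) that by (simp add: T_def)
    show "c x \<le> (\<Sum>i\<in>UNIV. \<phi> i (x i))" if "x \<in> F" for x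
      unfolding Gx[OF that, symmetric] using gpos[OF that] eps by (simp add: G_def)
    have "(\<Sum>x\<in>F. g x * ((\<Sum>i\<in>UNIV. \<phi> i (x i)) - c x)) = (\<Sum>x\<in>F. \<epsilon>)"
    proof (rule sum.cong[OF refl])
      fix x assume x: "x \<in> F"
      show "g x * ((\<Sum>i\<in>UNIV. \<phi> i (x i)) - c x) = \<epsilon>"
        unfolding Gx[OF x, symmetric] using gpos[OF x] by (simp add: G_def)
    qed
    also have "\<dots> \<le> e"
      using e by (simp add: \<epsilon>_def field_simps)
    finally show "(\<Sum>x\<in>F. g x * ((\<Sum>i\<in>UNIV. \<phi> i (x i)) - c x)) \<le> e" .
  qed
qed

section \<open>Limits of cylinder weights\<close>

text \<open>Diagonal argument; a complete linear order is sequentially compact, so extended-real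
  values always have convergent subsequences. It serves both the weights of boxes and the local
  infima of potentials.\<close>

lemma convergent_subsequence_countable:
  fixes f :: "nat \<Rightarrow> 'k::countable \<Rightarrow> 'b::{complete_linorder,linorder_topology}"
  shows "\<exists>r l. strict_mono r \<and> (\<forall>k. (\<lambda>n. f (r n) k) \<longlonglongrightarrow> l k)"
proof -
  let ?P = "\<lambda>n s. \<exists>l. (\<lambda>i. f (s i) (from_nat n)) \<longlonglongrightarrow> l"
  interpret subseqs ?P
  proof
    fix n and s :: "nat \<Rightarrow> nat"
    show "\<exists>r'. strict_mono r' \<and> ?P n (s \<circ> r')"
      using compact_complete_linorder[of "\<lambda>i. f (s i) (from_nat n)"] by (auto simp: o_def)
  qed
  have "\<exists>l. (\<lambda>i. f (diagseq i) k) \<longlonglongrightarrow> l" for k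
  proof -
    have "?P (to_nat k) (diagseq \<circ> ((+) (Suc (to_nat k))))"
    proof (rule diagseq_holds)
      fix r s :: "nat \<Rightarrow> nat" and n assume "strict_mono r" "?P n s"
      thus "?P n (s \<circ> r)" using LIMSEQ_subseq_LIMSEQ[of "\<lambda>i. f (s i) (from_nat n)" _ r]
        by (auto simp: o_def)
    qed
    then obtain l where "(\<lambda>i. f (diagseq (i + Suc (to_nat k))) k) \<longlonglongrightarrow> l"
      by (auto simp: add.commute)
    thus ?thesis by (blast intro: LIMSEQ_offset)
  qed
  hence "\<exists>l. \<forall>k. (\<lambda>i. f (diagseq i) k) \<longlonglongrightarrow> l k"
    by (intro choice allI)
  thus ?thesis using subseq_diagseq by blast
qed

text \<open>A binary word of length \<open>n\<close> is coded by the set of positions of its ones.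
  The two children of an interval lie side by side, the one with digit 0 on the left.\<close>

primrec tree_left :: "(nat \<Rightarrow> nat set \<Rightarrow> real) \<Rightarrow> nat \<Rightarrow> nat set \<Rightarrow> real" where
  "tree_left G 0 A = 0"
| "tree_left G (Suc n) A = tree_left G n (A - {n}) + (if n \<in> A then G (Suc n) (A - {n}) else 0)"

text \<open>The inverse reading: each new digit of \<omega> compares it with the point that
  separates the two children of its current interval.\<close>

primrec tree_digits :: "(nat \<Rightarrow> nat set \<Rightarrow> real) \<Rightarrow> nat \<Rightarrow> real \<Rightarrow> nat set" where
  "tree_digits G 0 \<omega> = {}"
| "tree_digits G (Suc n) \<omega> =
     (if \<omega> \<ge> tree_left G n (tree_digits G n \<omega>) + G (Suc n) (tree_digits G n \<omega>)
      then insert n (tree_digits G n \<omega>) else tree_digits G n \<omega>)"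

lemma tree_digits_subset: "tree_digits G n \<omega> \<subseteq> {..<n}"
  by (induction n) (auto simp: less_Suc_eq)

text \<open>Stage \<open>k + 1\<close> decides digit \<open>k\<close> and no later stage revises it,
  so the codes of all depths are truncations of one digit sequence.\<close>

lemma tree_digits_eq_Collect: "tree_digits G n \<omega> = {k. k < n \<and> k \<in> tree_digits G (Suc k) \<omega>}"
proof (induction n)
  case (Suc n)
  have "n \<notin> tree_digits G n \<omega>" using tree_digits_subset[of G n \<omega>] by auto
  have "tree_digits G (Suc n) \<omega> = tree_digits G n \<omega> \<union> {k. k = n \<and> k \<in> tree_digits G (Suc k) \<omega>}"
    using \<open>n \<notin> _\<close> by auto
  thus ?case by (subst (asm) Suc.IH) (auto simp: less_Suc_eq simp del: tree_digits.simps)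
qed simp

text \<open>A consistent system of cylinder weights is realised on the unit interval by nested intervals:
  the cylinder of depth \<open>n\<close> with digit set \<open>A\<close> becomes the interval of length \<open>G n A\<close>
  starting at \<open>tree_left G n A\<close>.\<close>

context
  fixes G :: "nat \<Rightarrow> nat set \<Rightarrow> real"
  assumes G_0: "G 0 {} = 1" and G_nonneg: "\<And>n A. A \<subseteq> {..<n} \<Longrightarrow> G n A \<ge> 0"
    and G_split: "\<And>n A. A \<subseteq> {..<n} \<Longrightarrow> G n A = G (Suc n) A + G (Suc n) (insert n A)"
begin

lemma tree_left_bounds:
  assumes "A \<subseteq> {..<n}"
  shows "0 \<le> tree_left G n A" "tree_left G n A + G n A \<le> 1"
  using assms
proof (induction n arbitrary: A)
  case 0
  {
    case 1 show ?case by simp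
  next
    case 2 thus ?case using G_0 by simp
  }
next
  case (Suc n)
  have sub: "A - {n} \<subseteq> {..<n}" if "A \<subseteq> {..<Suc n}" for A using that by (auto simp: less_Suc_eq)
  {
    case 1
    have "A - {n} \<subseteq> {..<Suc n}" using sub[OF 1] by auto
    thus ?case using Suc.IH(1)[OF sub[OF 1]] G_nonneg[of "A - {n}" "Suc n"] by simp
  next
    case 2
    have "A - {n} \<subseteq> {..<Suc n}" "insert n (A - {n}) \<subseteq> {..<Suc n}" using sub[OF 2] by auto
    hence "G (Suc n) (A - {n}) \<ge> 0" "G (Suc n) (insert n (A - {n})) \<ge> 0"
      by (auto intro!: G_nonneg)
    moreover have "n \<in> A \<Longrightarrow> insert n (A - {n}) = A" "n \<notin> A \<Longrightarrow> A - {n} = A" by auto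
    ultimately show ?case
      using Suc.IH(2)[OF sub[OF 2]] G_split[OF sub[OF 2]] by (cases "n \<in> A") auto
  }
qed

text \<open>By \<open>G_split\<close> the two half-open children tile their parent, so membership in
  a child is membership in the parent plus one comparison with the separating point.\<close>

lemma tree_digits_iff:
  assumes "A \<subseteq> {..<n}" "0 \<le> \<omega>" "\<omega> < 1"
  shows "tree_digits G n \<omega> = A \<longleftrightarrow> \<omega> \<in> {tree_left G n A..<tree_left G n A + G n A}"
  using assms(1)
proof (induction n arbitrary: A)
  case 0
  thus ?case using assms G_0 by simp
next
  case (Suc n)
  let ?A = "A - {n}"
  have sub: "?A \<subseteq> {..<n}" using Suc.prems by (auto simp: less_Suc_eq)
  have nn: "n \<notin> tree_digits G n \<omega>" using tree_digits_subset[of G n \<omega>] by auto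
  have "G (Suc n) ?A \<ge> 0" "G (Suc n) (insert n ?A) \<ge> 0"
    using sub by (auto intro!: G_nonneg)
  have "tree_digits G (Suc n) \<omega> = A \<longleftrightarrow>
      tree_digits G n \<omega> = ?A \<and> (n \<in> A \<longleftrightarrow> \<omega> \<ge> tree_left G n ?A + G (Suc n) ?A)"
  proof -
    have "(if b then insert n D else D) = A \<longleftrightarrow> D = A - {n} \<and> (n \<in> A \<longleftrightarrow> b)"
      if "n \<notin> D" for b and D :: "nat set"
      using that by (cases b) auto
    from this[OF nn] show ?thesis unfolding tree_digits.simps by metis
  qed
  also have "\<dots> \<longleftrightarrow> \<omega> \<in> {tree_left G n ?A..<tree_left G n ?A + G n ?A} \<and>
      (n \<in> A \<longleftrightarrow> \<omega> \<ge> tree_left G n ?A + G (Suc n) ?A)"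
    by (simp only: Suc.IH[OF sub])
  also have "\<dots> \<longleftrightarrow> \<omega> \<in> {tree_left G (Suc n) A..<tree_left G (Suc n) A + G (Suc n) A}"
  proof (cases "n \<in> A")
    case True
    hence "insert n ?A = A" by auto
    thus ?thesis
      using True G_split[OF sub] \<open>G (Suc n) ?A \<ge> 0\<close> by auto
  next
    case False
    thus ?thesis
      using G_split[OF sub] \<open>G (Suc n) (insert n ?A) \<ge> 0\<close> by auto
  qed
  finally show ?case .
qed

lemma tree_digits_cylinder:
  assumes "A \<subseteq> {..<n}"
  shows "{\<omega>\<in>{0..<1}. tree_digits G n \<omega> = A} = {tree_left G n A..<tree_left G n A + G n A}"
proof (rule set_eqI)
  fix \<omega>
  have "\<omega> \<in> {0..<1}" if "\<omega> \<in> {tree_left G n A..<tree_left G n A + G n A}"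
    using that tree_left_bounds[OF assms] by auto
  moreover have "tree_digits G n \<omega> = A \<longleftrightarrow> \<omega> \<in> {tree_left G n A..<tree_left G n A + G n A}" if "\<omega> \<in> {0..<1}"
    using that by (intro tree_digits_iff[OF assms]) auto
  ultimately show "\<omega> \<in> {\<omega>\<in>{0..<1}. tree_digits G n \<omega> = A} \<longleftrightarrow>
      \<omega> \<in> {tree_left G n A..<tree_left G n A + G n A}" by blast
qed

text \<open>An elementary substitute for Kolmogorov's extension theorem on binary sequences: the
  probability of a word is the length of its interval.\<close>

lemma ex_random_digits:
  shows "\<exists>\<delta>. (\<forall>k. Measurable.pred (restrict_space lborel {0..<1::real}) (\<delta> k)) \<and>
     (\<forall>n. \<forall>A\<subseteq>{..<n}. measure (restrict_space lborel {0..<1}) {\<omega>\<in>{0..<1}. {k. k < n \<and> \<delta> k \<omega>} = A} = G n A)"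
proof (intro exI conjI allI impI)
  let ?\<delta> = "\<lambda>k \<omega>. k \<in> tree_digits G (Suc k) \<omega>"
  let ?M = "restrict_space lborel {0..<1::real}"
  have cyl: "{\<omega>\<in>{0..<1}. tree_digits G n \<omega> = A} \<in> sets ?M" if "A \<subseteq> {..<n}" for n A
    using tree_left_bounds[OF that] unfolding tree_digits_cylinder[OF that]
    by (auto simp: sets_restrict_space_iff)
  show "Measurable.pred ?M (?\<delta> k)" for k
  proof -
    have "{\<omega>\<in>space ?M. ?\<delta> k \<omega>} =
        (\<Union>A\<in>{A\<in>Pow {..<Suc k}. k \<in> A}. {\<omega>\<in>{0..<1}. tree_digits G (Suc k) \<omega> = A})"
      using tree_digits_subset[of G "Suc k"] by (auto simp del: tree_digits.simps)
    also have "\<dots> \<in> sets ?M" by (intro sets.finite_UN cyl) auto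
    finally show ?thesis by (simp add: pred_def)
  qed
  show "measure ?M {\<omega>\<in>{0..<1}. {k. k < n \<and> ?\<delta> k \<omega>} = A} = G n A" if A: "A \<subseteq> {..<n}" for n A
  proof -
    have "{\<omega>\<in>{0..<1}. {k. k < n \<and> ?\<delta> k \<omega>} = A} = {tree_left G n A..<tree_left G n A + G n A}"
      unfolding tree_digits_eq_Collect[symmetric] by (rule tree_digits_cylinder[OF A])
    thus ?thesis
      using tree_left_bounds[OF A] G_nonneg[OF A] by (simp add: measure_restrict_space)
  qed
qed

end

lemma prob_space_unit_interval: "prob_space (restrict_space lborel {0..<1::real})"
  by (rule prob_space_restrict_space) auto

text \<open>Along a diagonal subsequence the weights of all words converge. The limits inherit
  nonnegativity, total mass 1 and additivity under splitting, so they are the law of random digits;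
  an event about \<open>N\<close> digits is a finite union of words.\<close>

lemma ex_limit_digits:
  fixes B F :: "nat \<Rightarrow> 'a set" and g :: "nat \<Rightarrow> 'a \<Rightarrow> real"
  assumes fin: "\<And>n. finite (F n)" and nonneg: "\<And>n X. X \<in> F n \<Longrightarrow> g n X \<ge> 0"
    and sum1: "\<And>n. (\<Sum>X\<in>F n. g n X) = 1"
  defines "M \<equiv> restrict_space lborel {0..<1::real}"
  shows "\<exists>r \<delta>. strict_mono r \<and> (\<forall>k. Measurable.pred M (\<delta> k)) \<and>
     (\<forall>N Q. (\<lambda>n. \<Sum>X\<in>{X\<in>F (r n). Q {k. k < N \<and> X \<in> B k}}. g (r n) X)
        \<longlonglongrightarrow> measure M {\<omega>\<in>{0..<1}. Q {k. k < N \<and> \<delta> k \<omega>}})"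
proof -
  interpret prob_space M unfolding M_def by (rule prob_space_unit_interval)
  define dig where "dig = (\<lambda>N X. {k. k < N \<and> X \<in> B k})"
  have dig_sub: "dig N X \<subseteq> {..<N}" for N X by (auto simp: dig_def)
  define W where "W = (\<lambda>n N A. \<Sum>X\<in>{X\<in>F n. dig N X = A}. g n X)"
  have W_nonneg: "W n N A \<ge> 0" for n N A
    unfolding W_def by (intro sum_nonneg nonneg) auto
  have W_le: "W n N A \<le> 1" for n N A
    unfolding sum1[of n, symmetric] W_def by (rule sum_mono2) (use fin nonneg in auto)
  obtain r l where r: "strict_mono r" and
    l: "\<And>k. (\<lambda>n. ereal (W (r n) (fst k) (set_decode (snd k)))) \<longlonglongrightarrow> l k"
    using convergent_subsequence_countable[of "\<lambda>n k. ereal (W n (fst k) (set_decode (snd k)))"] by blast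
  \<comment> \<open>\<open>set_encode\<close> makes the index of the diagonal argument countable.
    The limits, taken in the extended reals for compactness, lie between 0 and 1 and return to the
    reals.\<close>
  define G where "G = (\<lambda>N A. real_of_ereal (l (N, set_encode A)))"
  have lim: "(\<lambda>n. W (r n) N A) \<longlonglongrightarrow> G N A" if "A \<subseteq> {..<N}" for N A
  proof -
    have "finite A" using that finite_subset by blast
    hence *: "(\<lambda>n. ereal (W (r n) N A)) \<longlonglongrightarrow> l (N, set_encode A)"
      using l[of "(N, set_encode A)"] by (simp add: set_encode_inverse)
    have "0 \<le> l (N, set_encode A)"
      by (rule LIMSEQ_le_const[OF *]) (use W_nonneg in auto)
    moreover have "l (N, set_encode A) \<le> 1"
      by (rule LIMSEQ_le_const2[OF *]) (use W_le in auto)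
    ultimately have "l (N, set_encode A) = ereal (G N A)"
      by (cases "l (N, set_encode A)") (auto simp: G_def)
    thus ?thesis using * by simp
  qed
  have G0: "G 0 {} = 1"
  proof (rule LIMSEQ_unique[OF lim])
    show "(\<lambda>n. W (r n) 0 {}) \<longlonglongrightarrow> 1" by (simp add: W_def dig_def sum1)
  qed auto
  have Gnn: "G N A \<ge> 0" if "A \<subseteq> {..<N}" for N A
    by (rule LIMSEQ_le_const[OF lim[OF that]]) (use W_nonneg in auto)
  have Gsplit: "G N A = G (Suc N) A + G (Suc N) (insert N A)" if A: "A \<subseteq> {..<N}" for N A
  proof (rule LIMSEQ_unique[OF lim[OF A]])
    have "W n N A = W n (Suc N) A + W n (Suc N) (insert N A)" for n
    proof -
      have dS: "dig (Suc N) X = (if X \<in> B N then insert N (dig N X) else dig N X)" for X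
        by (auto simp: dig_def less_Suc_eq)
      have "dig N X = A \<longleftrightarrow> dig (Suc N) X = A \<or> dig (Suc N) X = insert N A" for X
        using A dig_sub[of N X] unfolding dS by (auto split: if_splits)
      hence "{X\<in>F n. dig N X = A} = {X\<in>F n. dig (Suc N) X = A} \<union> {X\<in>F n. dig (Suc N) X = insert N A}"
        by auto
      moreover have "A \<noteq> insert N A" using A by auto
      ultimately show ?thesis
        unfolding W_def by (simp only:) (rule sum.union_disjoint, use fin in auto)
    qed
    moreover have "A \<subseteq> {..<Suc N}" "insert N A \<subseteq> {..<Suc N}" using A by auto
    ultimately show "(\<lambda>n. W (r n) N A) \<longlonglongrightarrow> G (Suc N) A + G (Suc N) (insert N A)"
      by (simp only:) (intro tendsto_add lim)
  qed
  have "\<exists>\<delta>. (\<forall>k. Measurable.pred M (\<delta> k)) \<and>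
     (\<forall>n. \<forall>A\<subseteq>{..<n}. measure M {\<omega>\<in>{0..<1}. {k. k < n \<and> \<delta> k \<omega>} = A} = G n A)"
    unfolding M_def
  proof (rule ex_random_digits[of G])
    show "G 0 {} = 1" by (rule G0)
    show "0 \<le> G n A" if "A \<subseteq> {..<n}" for n A using that by (rule Gnn)
    show "G n A = G (Suc n) A + G (Suc n) (insert n A)" if "A \<subseteq> {..<n}" for n A
      using that by (rule Gsplit)
  qed
  then obtain \<delta> where d: "\<forall>k. Measurable.pred M (\<delta> k)"
    and dG: "\<forall>n. \<forall>A\<subseteq>{..<n}. measure M {\<omega>\<in>{0..<1}. {k. k < n \<and> \<delta> k \<omega>} = A} = G n A"
    by (elim exE conjE)
  note d = d[rule_format] and dG = dG[rule_format]
  have sp: "space M = {0..<1}" by (simp add: M_def space_restrict_space)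
  have "(\<lambda>n. \<Sum>X\<in>{X\<in>F (r n). Q (dig N X)}. g (r n) X)
        \<longlonglongrightarrow> measure M {\<omega>\<in>{0..<1}. Q {k. k < N \<and> \<delta> k \<omega>}}" for N Q
  proof -
    let ?As = "{A\<in>Pow {..<N}. Q A}"
    have "(\<Sum>X\<in>{X\<in>F n. Q (dig N X)}. g n X) = (\<Sum>A\<in>?As. W n N A)" for n
    proof -
      have "{X\<in>F n. Q (dig N X)} = (\<Union>A\<in>?As. {X\<in>F n. dig N X = A})"
        using dig_sub by auto
      thus ?thesis unfolding W_def
        by (simp only:) (rule sum.UNION_disjoint, use fin in auto)
    qed
    moreover have "measure M {\<omega>\<in>{0..<1}. Q {k. k < N \<and> \<delta> k \<omega>}} = (\<Sum>A\<in>?As. G N A)"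
    proof -
      let ?C = "\<lambda>A. {\<omega>\<in>space M. {k. k < N \<and> \<delta> k \<omega>} = A}"
      have C: "?C A \<in> sets M" for A
      proof -
        have "?C A = {\<omega>\<in>space M. A \<subseteq> {..<N} \<and> (\<forall>k<N. \<delta> k \<omega> \<longleftrightarrow> k \<in> A)}" by auto
        also have "\<dots> \<in> sets M" using d by measurable
        finally show ?thesis .
      qed
      have "{\<omega>\<in>{0..<1}. Q {k. k < N \<and> \<delta> k \<omega>}} = (\<Union>A\<in>?As. ?C A)"
        by (auto simp: sp)
      also have "measure M \<dots> = (\<Sum>A\<in>?As. measure M (?C A))"
        by (rule finite_measure_finite_Union) (use C in \<open>auto simp: disjoint_family_on_def\<close>)
      also have "\<dots> = (\<Sum>A\<in>?As. G N A)"
        unfolding sp by (intro sum.cong refl dG) auto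
      finally show ?thesis .
    qed
    ultimately show ?thesis
      by (simp only:) (intro tendsto_sum lim, auto)
  qed
  thus ?thesis
    unfolding dig_def by (intro exI[of _ r] exI[of _ \<delta>] conjI allI r d)
qed

section \<open>Limits of couplings\<close>

text \<open>\<open>from_nat\<close> enumerates pairs of a coordinate and a rational threshold, so
  that a point is determined by the sequence of its memberships.\<close>

definition halfspace :: "nat \<Rightarrow> (real ^ 'd::finite) set" where
  "halfspace k = {x. x $ fst (from_nat k :: 'd \<times> rat) < of_rat (snd (from_nat k :: 'd \<times> rat))}"

text \<open>Points with equal codes form one box of the partition of depth \<open>n\<close>; deeper
  codes refine it.\<close>

definition cell_code :: "nat \<Rightarrow> real ^ 'd::finite \<Rightarrow> nat set" where
  "cell_code n x = {k. k < n \<and> x \<in> halfspace k}"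

text \<open>A coordinate is the infimum of the thresholds it lies below. Digit sequences of no point
  also decode to some vector, \<open>real_of_ereal\<close> sending infinite values to 0, so decoding
  is a total measurable map.\<close>

definition halfspace_decode :: "(nat \<Rightarrow> bool) \<Rightarrow> real ^ 'd::finite" where
  "halfspace_decode f = (\<chi> j. real_of_ereal
     (INF k. if f k \<and> fst (from_nat k :: 'd \<times> rat) = j
             then ereal (of_rat (snd (from_nat k :: 'd \<times> rat))) else \<infinity>))"

abbreviation bool_sequences :: "(nat \<Rightarrow> bool) measure" where
  "bool_sequences \<equiv> PiM UNIV (\<lambda>_. count_space UNIV)"

lemma mem_halfspace_to_nat [simp]:
  "x \<in> halfspace (to_nat (j, q)) \<longleftrightarrow> x $ j < of_rat q"
  by (simp add: halfspace_def)

lemma sets_halfspace [measurable, simp]: "halfspace k \<in> sets borel"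
  unfolding halfspace_def by (intro borel_open open_Collect_less continuous_intros)

lemma finite_range_cell_code: "finite (range (cell_code n))"
  by (rule finite_subset[of _ "Pow {..<n}"]) (auto simp: cell_code_def)

lemma sets_cell_code [measurable, simp]: "{x. Q (cell_code n x)} \<in> sets borel"
proof -
  have "{x. Q (cell_code n x)} = (\<Union>u\<in>{u\<in>Pow {..<n}. Q u}. {x. cell_code n x = u})"
    by (auto simp: cell_code_def)
  also have "\<dots> \<in> sets borel"
  proof (intro sets.finite_UN)
    fix u assume "u \<in> {u\<in>Pow {..<n}. Q u}"
    hence "{x. cell_code n x = u} = {x\<in>space borel. \<forall>k<n. x \<in> halfspace k \<longleftrightarrow> k \<in> u}"
      by (auto simp: cell_code_def)
    also have "\<dots> \<in> sets borel" by measurable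
    finally show "{x. cell_code n x = u} \<in> sets borel" .
  qed auto
  finally show ?thesis .
qed

lemma halfspace_decode_encode: "halfspace_decode (\<lambda>k. x \<in> halfspace k) = (x :: real ^ 'd::finite)"
proof -
  have "(INF k. if x \<in> halfspace k \<and> fst (from_nat k :: 'd \<times> rat) = j
             then ereal (of_rat (snd (from_nat k :: 'd \<times> rat))) else \<infinity>) = ereal (x $ j)" (is "Inf (range ?f) = _") for j
  proof (rule antisym)
    show "ereal (x $ j) \<le> (INF k. ?f k)"
      by (rule INF_greatest) (auto simp: halfspace_def)
    show "(INF k. ?f k) \<le> ereal (x $ j)"
    proof (rule dense_ge)
      fix y assume "ereal (x $ j) < y"
      then obtain z where z: "ereal (x $ j) < ereal z" "ereal z \<le> y"
        using ereal_dense2 less_imp_le by metis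
      then obtain q where q: "x $ j < of_rat q" "of_rat q < z"
        using of_rat_dense[of "x $ j" z] by auto
      have "(INF k. ?f k) \<le> ?f (to_nat (j, q))" by (rule INF_lower) auto
      also have "\<dots> = ereal (of_rat q)" using q by simp
      also have "\<dots> \<le> y" using q z by (meson ereal_less_eq(3) less_imp_le order_trans)
      finally show "(INF k. ?f k) \<le> y" .
    qed
  qed
  thus ?thesis by (simp add: halfspace_decode_def vec_eq_iff)
qed

lemma borel_measurable_vecI:
  fixes f :: "'a \<Rightarrow> 'b::euclidean_space ^ 'd::finite"
  assumes "\<And>i. (\<lambda>x. f x $ i) \<in> borel_measurable M"
  shows "f \<in> borel_measurable M"
proof -
  have "(\<lambda>x. f x \<bullet> b) \<in> borel_measurable M" if b: "b \<in> Basis" for b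
  proof -
    obtain i u where "b = axis i u" using b by (auto simp: Basis_vec_def)
    hence "(\<lambda>x. f x \<bullet> b) = (\<lambda>x. f x $ i \<bullet> u)" by (simp add: inner_axis)
    thus ?thesis using assms[of i] by (simp add: borel_measurable_inner)
  qed
  thus ?thesis by (subst borel_measurable_euclidean_space) auto
qed

lemma measurable_halfspace_decode [measurable]:
  "(halfspace_decode :: _ \<Rightarrow> real ^ 'd::finite) \<in> borel_measurable bool_sequences"
proof (rule borel_measurable_vecI)
  fix j :: 'd
  have [measurable]: "Measurable.pred bool_sequences (\<lambda>f. f k)" for k
    by (rule measurable_component_singleton) auto
  show "(\<lambda>f. halfspace_decode f $ j) \<in> borel_measurable bool_sequences"
    unfolding halfspace_decode_def vec_lambda_beta by measurable
qed

lemma measurable_bool_sequences: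
  assumes "\<And>k. Measurable.pred M (\<lambda>x. f x k)"
  shows "f \<in> measurable M bool_sequences"
proof (rule measurable_PiM_single')
  show "f \<in> space M \<rightarrow> UNIV \<rightarrow>\<^sub>E space (count_space UNIV)" by auto
qed (use assms in auto)

text \<open>The marginals of the limit are \<open>\<mu>\<close> by assumption, so the digits of the limit are almost surely
  the digits of a point: this replaces tightness.\<close>

lemma ex_limit_coupling:
  fixes \<mu> :: "'d::finite \<Rightarrow> (real ^ 'd) measure"
    and F :: "nat \<Rightarrow> (real ^ 'd ^ 'd) set" and g :: "nat \<Rightarrow> real ^ 'd ^ 'd \<Rightarrow> real"
  assumes prob: "\<And>i. prob_space (\<mu> i)" and borel: "\<And>i. sets (\<mu> i) = sets borel"
    and fin: "\<And>n. finite (F n)" and nonneg: "\<And>n X. X \<in> F n \<Longrightarrow> g n X \<ge> 0"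
    and sum1: "\<And>n. (\<Sum>X\<in>F n. g n X) = 1"
    and marg: "\<And>n N i Q. N \<le> n \<Longrightarrow> (\<Sum>X\<in>{X\<in>F n. Q (cell_code N (X $ i))}. g n X) = measure (\<mu> i) {x. Q (cell_code N x)}"
  shows "\<exists>\<gamma>\<in>couplings \<mu>. \<exists>r. strict_mono r \<and>
     (\<forall>N T. (\<lambda>n. \<Sum>X\<in>{X\<in>F (r n). \<forall>i. cell_code N (X $ i) = T i}. g (r n) X)
        \<longlonglongrightarrow> measure \<gamma> {X. \<forall>i. cell_code N (X $ i) = T i})"
proof -
  let ?M = "restrict_space lborel {0..<1::real}"
  interpret M: prob_space ?M by (rule prob_space_unit_interval)
  \<comment> \<open>Pairs of a row and a half-space are enumerated, so that all rows of
    \<open>X\<close> share one digit sequence.\<close>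
  define B :: "nat \<Rightarrow> (real ^ 'd ^ 'd) set" where
    "B = (\<lambda>k. {X. X $ fst (from_nat k :: 'd \<times> nat) \<in> halfspace (snd (from_nat k :: 'd \<times> nat))})"
  have "\<exists>r \<delta>. strict_mono r \<and> (\<forall>k. Measurable.pred ?M (\<delta> k)) \<and>
     (\<forall>N Q. (\<lambda>n. \<Sum>X\<in>{X\<in>F (r n). Q {k. k < N \<and> X \<in> B k}}. g (r n) X)
        \<longlonglongrightarrow> measure ?M {\<omega>\<in>{0..<1}. Q {k. k < N \<and> \<delta> k \<omega>}})"
    by (rule ex_limit_digits[OF fin nonneg sum1])
  then obtain r \<delta> where r: "strict_mono r" and \<delta> [rule_format]: "\<forall>k. Measurable.pred ?M (\<delta> k)" and
    lim [rule_format]: "\<forall>N Q. (\<lambda>n. \<Sum>X\<in>{X\<in>F (r n). Q {k. k < N \<and> X \<in> B k}}. g (r n) X)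
        \<longlonglongrightarrow> measure ?M {\<omega>\<in>{0..<1}. Q {k. k < N \<and> \<delta> k \<omega>}}"
    by (elim exE conjE)
  define D where "D = (\<lambda>i \<omega> l. \<delta> (to_nat (i :: 'd, l :: nat)) \<omega>)"
  have [measurable]: "Measurable.pred ?M (\<lambda>\<omega>. D i \<omega> l)" for i l
    unfolding D_def by (rule \<delta>)
  have D_meas [measurable]: "D i \<in> measurable ?M bool_sequences" for i
    by (rule measurable_bool_sequences) measurable
  have sp: "space ?M = {0..<1}" by simp
  have limD: "(\<lambda>n. \<Sum>X\<in>{X\<in>F (r n). Q (\<lambda>i. cell_code N (X $ i))}. g (r n) X)
      \<longlonglongrightarrow> measure ?M {\<omega>\<in>{0..<1}. Q (\<lambda>i. {l. l < N \<and> D i \<omega> l})}" for N Q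
  proof -
    \<comment> \<open>A joint depth that includes the first \<open>N\<close> digits of every
      row.\<close>
    define N' where "N' = Suc (Max (to_nat ` ((UNIV :: 'd set) \<times> {..<N})))"
    have N': "to_nat (i :: 'd, l) < N'" if "l < N" for i l
      unfolding N'_def less_Suc_eq_le by (rule Max_ge) (use that in auto)
    let ?Q = "\<lambda>S. Q (\<lambda>i. {l. l < N \<and> to_nat (i, l) \<in> S})"
    have "{l. l < N \<and> to_nat (i, l) \<in> {k. k < N' \<and> X \<in> B k}} = cell_code N (X $ i)" for i X
      using N' by (auto simp: B_def cell_code_def)
    moreover have "{l. l < N \<and> to_nat (i, l) \<in> {k. k < N' \<and> \<delta> k \<omega>}} = {l. l < N \<and> D i \<omega> l}" for i \<omega>
      using N' by (auto simp: D_def)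
    ultimately show ?thesis using lim[of ?Q N'] by simp
  qed
  \<comment> \<open>The finite marginals are exact once \<open>N \<le> r n\<close>, so the
    converging sequence is eventually constant.\<close>
  have limD1: "measure ?M {\<omega>\<in>{0..<1}. Q {l. l < N \<and> D i \<omega> l}} = measure (\<mu> i) {x. Q (cell_code N x)}" for N Q i
  proof (rule LIMSEQ_unique[OF limD[of "\<lambda>c. Q (c i)" N]])
    have "\<forall>\<^sub>F n in sequentially. N \<le> r n"
      using filterlim_subseq[OF r] by (simp add: filterlim_at_top)
    hence "\<forall>\<^sub>F n in sequentially. measure (\<mu> i) {x. Q (cell_code N x)} =
        (\<Sum>X\<in>{X\<in>F (r n). Q (cell_code N (X $ i))}. g (r n) X)"
      by eventually_elim (simp add: marg)
    thus "(\<lambda>n. \<Sum>X\<in>{X\<in>F (r n). Q (cell_code N (X $ i))}. g (r n) X)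
        \<longlonglongrightarrow> measure (\<mu> i) {x. Q (cell_code N x)}"
      using tendsto_const by (rule Lim_transform_eventually[rotated])
  qed
  define enc where "enc = (\<lambda>x :: real ^ 'd. \<lambda>l. x \<in> halfspace l)"
  have enc_meas: "enc \<in> measurable (\<mu> i) bool_sequences" for i
    unfolding measurable_cong_sets[OF borel refl] enc_def
    by (rule measurable_bool_sequences) measurable
  \<comment> \<open>Finite cylinders determine a law on binary sequences, and on them the two sides
    agree by \<open>limD1\<close>.\<close>
  have law: "distr ?M bool_sequences (D i) = distr (\<mu> i) bool_sequences enc" for i
  proof (rule measure_eqI_PiM_infinite[where I = UNIV and M = "\<lambda>_. count_space UNIV"])
    interpret \<mu>: prob_space "\<mu> i" by (rule prob)
    show "finite_measure (distr ?M bool_sequences (D i))"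
      by (rule prob_space.finite_measure[OF M.prob_space_distr]) simp
    fix A :: "nat \<Rightarrow> bool set" and J :: "nat set" assume J: "finite J"
    let ?C = "prod_emb UNIV (\<lambda>_. count_space UNIV) J (Pi\<^sub>E J A)"
    have C: "?C \<in> sets bool_sequences"
      using J by (intro sets_PiM_I) auto
    define N where "N = Suc (Max (insert 0 J))"
    have N: "j < N" if "j \<in> J" for j
      unfolding N_def less_Suc_eq_le by (rule Max_ge) (use J that in auto)
    let ?Q = "\<lambda>u. \<forall>j\<in>J. (j \<in> u) \<in> A j"
    have mem: "f \<in> ?C \<longleftrightarrow> (\<forall>j\<in>J. f j \<in> A j)" for f :: "nat \<Rightarrow> bool"
      by (auto simp: prod_emb_def PiE_iff)
    have "D i -` ?C \<inter> space ?M = {\<omega>\<in>{0..<1}. ?Q {l. l < N \<and> D i \<omega> l}}"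
      using N by (auto simp: mem)
    moreover have "enc -` ?C \<inter> space (\<mu> i) = {x. ?Q (cell_code N x)}"
      using N sets_eq_imp_space_eq[OF borel[of i]] by (auto simp: mem enc_def cell_code_def)
    ultimately show "emeasure (distr ?M bool_sequences (D i)) ?C = emeasure (distr (\<mu> i) bool_sequences enc) ?C"
      using C limD1[of ?Q N i]
      by (simp add: emeasure_distr enc_meas M.emeasure_eq_measure \<mu>.emeasure_eq_measure)
  qed auto
  \<comment> \<open>Being the digit sequence of its own decoding is a measurable property of a
    sequence. It holds for digits of points and passes over by equality of laws.\<close>
  have consistent: "AE \<omega> in ?M. \<forall>l. (halfspace_decode (D i \<omega>) \<in> (halfspace l :: (real ^ 'd) set)) = D i \<omega> l" for i
  proof (rule AE_distrD[OF D_meas[of i]])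
    have [measurable]: "Measurable.pred bool_sequences (\<lambda>f. f k)" for k
      by (rule measurable_component_singleton) auto
    have "AE x in \<mu> i. \<forall>l. (halfspace_decode (enc x) \<in> (halfspace l :: (real ^ 'd) set)) = enc x l"
      by (simp add: enc_def halfspace_decode_encode)
    moreover have "{f\<in>space bool_sequences. \<forall>l. (halfspace_decode f \<in> (halfspace l :: (real ^ 'd) set)) = f l} \<in> sets bool_sequences"
      by measurable
    ultimately show "AE f in distr ?M bool_sequences (D i).
        \<forall>l. (halfspace_decode f \<in> (halfspace l :: (real ^ 'd) set)) = f l"
      unfolding law by (subst AE_distr_iff[OF enc_meas])
  qed
  define R :: "real \<Rightarrow> real ^ 'd ^ 'd" where "R = (\<lambda>\<omega>. \<chi> i. halfspace_decode (D i \<omega>))"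
  have R_nth: "R \<omega> $ i = halfspace_decode (D i \<omega>)" for \<omega> i by (simp add: R_def)
  have R_meas [measurable]: "R \<in> borel_measurable ?M"
    by (rule borel_measurable_vecI) (simp add: R_nth)
  define \<gamma> where "\<gamma> = distr ?M borel R"
  have row_meas [measurable]: "(\<lambda>X. X $ i) \<in> borel_measurable (borel :: (real ^ 'd ^ 'd) measure)" for i
    by (intro borel_measurable_continuous_onI continuous_intros)
  have "distr \<gamma> borel (\<lambda>X. X $ i) = \<mu> i" for i
  proof -
    have "distr \<gamma> borel (\<lambda>X. X $ i) = distr ?M borel (halfspace_decode \<circ> D i)"
      unfolding \<gamma>_def by (subst distr_distr) (auto simp: o_def R_nth)
    also have "\<dots> = distr (distr ?M bool_sequences (D i)) borel halfspace_decode"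
      by (subst distr_distr) auto
    also have "\<dots> = distr (\<mu> i) borel (halfspace_decode \<circ> enc)"
      unfolding law by (subst distr_distr) (auto intro: enc_meas)
    also have "halfspace_decode \<circ> enc = (\<lambda>x. x)"
      by (auto simp: enc_def halfspace_decode_encode)
    also have "distr (\<mu> i) borel (\<lambda>x. x) = \<mu> i"
      by (rule distr_id2) (simp add: borel)
    finally show ?thesis .
  qed
  hence coup: "\<gamma> \<in> couplings \<mu>"
    by (auto simp: couplings_def \<gamma>_def intro!: M.prob_space_distr)
  have "measure \<gamma> {X. \<forall>i. cell_code N (X $ i) = T i} =
      measure ?M {\<omega>\<in>{0..<1}. \<forall>i. {l. l < N \<and> D i \<omega> l} = T i}" for N T
  proof -
    have cell: "{X\<in>space borel. \<forall>i. cell_code N (X $ i) = T i} \<in> sets (borel :: (real ^ 'd ^ 'd) measure)"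
    proof -
      have "{X. cell_code N (X $ i) = T i} \<in> sets (borel :: (real ^ 'd ^ 'd) measure)" for i
        using measurable_sets[OF row_meas sets_cell_code[of "\<lambda>u. u = T i" N]] by (simp add: vimage_def)
      thus ?thesis by (intro sets.sets_Collect) auto
    qed
    have "measure \<gamma> {X. \<forall>i. cell_code N (X $ i) = T i} = measure ?M {\<omega>\<in>space ?M. \<forall>i. cell_code N (R \<omega> $ i) = T i}"
      unfolding \<gamma>_def using cell by (subst measure_distr) (auto simp: vimage_def Int_def conj_commute)
    also have "\<dots> = measure ?M {\<omega>\<in>space ?M. \<forall>i. {l. l < N \<and> D i \<omega> l} = T i}"
    proof (rule M.finite_measure_eq_AE)
      have "AE \<omega> in ?M. \<forall>i l. (halfspace_decode (D i \<omega>) \<in> (halfspace l :: (real ^ 'd) set)) = D i \<omega> l"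
        using consistent by (subst AE_all_countable) auto
      thus "AE \<omega> in ?M. \<omega> \<in> {\<omega>\<in>space ?M. \<forall>i. cell_code N (R \<omega> $ i) = T i} \<longleftrightarrow>
          \<omega> \<in> {\<omega>\<in>space ?M. \<forall>i. {l. l < N \<and> D i \<omega> l} = T i}"
        by eventually_elim (simp add: cell_code_def R_nth)
      show "{\<omega>\<in>space ?M. \<forall>i. cell_code N (R \<omega> $ i) = T i} \<in> sets ?M"
        using measurable_sets[OF R_meas cell] by (simp add: vimage_def Int_def conj_commute)
      have "{\<omega>\<in>space ?M. \<forall>i. {l. l < N \<and> D i \<omega> l} = T i} =
          {\<omega>\<in>space ?M. \<forall>i. T i \<subseteq> {..<N} \<and> (\<forall>l<N. D i \<omega> l \<longleftrightarrow> l \<in> T i)}"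
        by (auto simp: set_eq_iff)
      also have "\<dots> \<in> sets ?M" by measurable
      finally show "{\<omega>\<in>space ?M. \<forall>i. {l. l < N \<and> D i \<omega> l} = T i} \<in> sets ?M" .
    qed
    finally show ?thesis by (simp only: sp)
  qed
  hence "(\<lambda>n. \<Sum>X\<in>{X\<in>F (r n). \<forall>i. cell_code N (X $ i) = T i}. g (r n) X)
      \<longlonglongrightarrow> measure \<gamma> {X. \<forall>i. cell_code N (X $ i) = T i}" for N T
    using limD[of "\<lambda>c. \<forall>i. c i = T i" N] by simp
  thus ?thesis
    by (intro bexI[OF _ coup] exI[of _ r] conjI allI r)
qed

section \<open>Limits of potentials\<close>

lemma ereal_less_add_split:
  assumes "ereal t < x + y" "x \<noteq> -\<infinity>" "y \<noteq> -\<infinity>"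
  shows "\<exists>s u. ereal s < x \<and> ereal u < y \<and> t < s + u"
proof (cases x)
  case (real a)
  show ?thesis
  proof (cases y)
    case (real b)
    let ?d = "(a + b - t) / 3"
    have "?d > 0" using assms \<open>x = ereal a\<close> real by simp
    hence "a - ?d < a" "b - ?d < b" "t < (a - ?d) + (b - ?d)" by (auto simp: field_simps)
    thus ?thesis using \<open>x = ereal a\<close> real by (intro exI[of _ "a - ?d"] exI[of _ "b - ?d"]) simp
  next
    case PInf
    thus ?thesis using real by (intro exI[of _ "a - 1"] exI[of _ "t - a + 2"]) simp
  qed (use assms in simp)
next
  case PInf
  obtain u where "ereal u < y"
    using assms(3) ereal_dense2[of "-\<infinity>" y] by auto
  thus ?thesis using PInf by (intro exI[of _ "t - u + 1"] exI[of _ u]) simp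
qed (use assms in simp)

text \<open>Distributes a strict real lower bound over the summands, some of which may be
  \<infinity>; each share can then be pursued through its own limit.\<close>

lemma ereal_less_sum_split:
  fixes F :: "'i \<Rightarrow> ereal"
  assumes "finite I" "ereal t < sum F I" "\<And>i. i \<in> I \<Longrightarrow> F i \<noteq> -\<infinity>"
  shows "\<exists>b. (\<forall>i\<in>I. ereal (b i) < F i) \<and> t < sum b I"
  using assms
proof (induction I arbitrary: t)
  case (insert j I)
  have "sum F I \<noteq> -\<infinity>" using insert.prems(2) by (intro sum_ereal_neq_MInfty) auto
  then obtain s u where su: "ereal s < F j" "ereal u < sum F I" "t < s + u"
    using ereal_less_add_split[of t "F j" "sum F I"] insert by auto
  obtain b where b: "\<forall>i\<in>I. ereal (b i) < F i" "u < sum b I"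
    using insert.IH[OF su(2)] insert.prems(2) by auto
  have "sum (b(j := s)) (insert j I) = s + sum b I"
    using insert.hyps by (simp add: sum.insert) (intro sum.cong, auto)
  moreover have "\<forall>i\<in>insert j I. ereal ((b(j := s)) i) < F i" using b su by auto
  ultimately show ?case using su b by (intro exI[of _ "b(j := s)"]) auto
qed simp

text \<open>The limit is the epigraphical (Gamma) limit along a subsequence: it is lower semicontinuous by
  construction, every \<open>X\<close> has a recovery sequence in each coordinate, and the liminf inequality
  transports small slackness near \<open>X \<in> \<Gamma>\<close> to slackness zero at \<open>X\<close>.\<close>

lemma ex_epi_limit_potentials:
  fixes S :: "nat \<Rightarrow> 'd::finite \<Rightarrow> 'a::euclidean_space set" and \<phi> :: "nat \<Rightarrow> 'd \<Rightarrow> 'a \<Rightarrow> real"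
    and c :: "'a ^ 'd \<Rightarrow> real" and A B :: real
  assumes cont: "continuous_on UNIV c"
    and adm: "\<And>n X. (\<And>i. X $ i \<in> S n i) \<Longrightarrow> c X \<le> (\<Sum>i\<in>UNIV. \<phi> n i (X $ i))"
    and B: "B \<ge> 0"
    and low: "\<forall>\<^sub>F n in sequentially. \<forall>i. \<forall>y\<in>S n i. - A - B * norm y \<le> \<phi> n i y"
    and slack: "\<And>X V e. X \<in> \<Gamma> \<Longrightarrow> open V \<Longrightarrow> X \<in> V \<Longrightarrow> e > 0 \<Longrightarrow>
        \<forall>\<^sub>F n in sequentially. \<exists>Y\<in>V. (\<forall>i. Y $ i \<in> S n i) \<and> (\<Sum>i\<in>UNIV. \<phi> n i (Y $ i)) \<le> c Y + e"
  shows "\<exists>\<Phi>. (\<forall>i. lower_semicontinuous (\<Phi> i)) \<and> (\<forall>i x. \<Phi> i x \<noteq> -\<infinity>) \<and>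
     (\<forall>X. ereal (c X) \<le> (\<Sum>i\<in>UNIV. \<Phi> i (X $ i))) \<and>
     (\<forall>X\<in>\<Gamma>. (\<Sum>i\<in>UNIV. \<Phi> i (X $ i)) = ereal (c X))"
proof -
  obtain \<B> :: "'a set set" where \<B>: "countable \<B>" "topological_basis \<B>"
    using ex_countable_basis by blast
  define U where "U = from_nat_into \<B>"
  have "\<B> \<noteq> {}" using topological_basisE[OF \<B>(2) open_UNIV UNIV_I] by auto
  hence U_open: "open (U k)" for k
    unfolding U_def by (intro topological_basis_open[OF \<B>(2)] from_nat_into)
  have U: "\<exists>k. x \<in> U k \<and> U k \<subseteq> V" if V: "open V" "x \<in> V" for x V
  proof -
    obtain W where "W \<in> \<B>" "x \<in> W" "W \<subseteq> V" by (rule topological_basisE[OF \<B>(2) V])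
    thus ?thesis using from_nat_into_surj[OF \<B>(1), of W] by (auto simp: U_def)
  qed
  \<comment> \<open>Local infima of the finite potentials, extended by \<infinity> off the atoms,
    over a countable base.\<close>
  define f where "f = (\<lambda>n (i, k). INF y\<in>U k. if y \<in> S n i then ereal (\<phi> n i y) else \<infinity>)"
  obtain r a where r: "strict_mono r" and a: "\<forall>z. (\<lambda>n. f (r n) z) \<longlonglongrightarrow> a z"
    using convergent_subsequence_countable[of f] by (elim exE conjE)
  note a = a[rule_format]
  \<comment> \<open>The supremum over basic neighbourhoods of the limiting local infima: the
    topological formula for a Gamma-limit.\<close>
  define \<Phi> where "\<Phi> = (\<lambda>i x. SUP k\<in>{k. x \<in> U k}. a (i, k))"
  have a_le: "a (i, k) \<le> \<Phi> i x" if "x \<in> U k" for i k x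
    unfolding \<Phi>_def by (rule SUP_upper) (use that in auto)
  have lsc: "lower_semicontinuous (\<Phi> i)" for i
    unfolding lower_semicontinuous_def
  proof
    fix t
    have "{x. t < \<Phi> i x} = (\<Union>k\<in>{k. t < a (i, k)}. U k)"
      by (auto simp: \<Phi>_def less_SUP_iff)
    thus "open {x. t < \<Phi> i x}" using U_open by auto
  qed
  \<comment> \<open>The affine minorant, uniform in \<open>n\<close>, bounds the infima over one
    neighbourhood inside the unit ball around \<open>x\<close>; this gives
    \<open>norm x + 1\<close>.\<close>
  have neq: "\<Phi> i x \<noteq> -\<infinity>" for i x
  proof -
    obtain k where k: "x \<in> U k" "U k \<subseteq> ball x 1" using U[of "ball x 1" x] by auto
    have "\<forall>\<^sub>F n in sequentially. \<forall>i. \<forall>y\<in>S (r n) i. - A - B * norm y \<le> \<phi> (r n) i y"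
      using low r by (rule eventually_subseq[rotated])
    hence "\<forall>\<^sub>F n in sequentially. ereal (- A - B * (norm x + 1)) \<le> f (r n) (i, k)"
    proof eventually_elim
      case (elim n)
      show ?case unfolding f_def prod.case
      proof (rule INF_greatest)
        fix y assume "y \<in> U k"
        hence "norm (x - y) < 1" using k(2) by (auto simp: dist_norm)
        hence "norm y \<le> norm x + 1" using norm_triangle_ineq2[of y x] by (simp add: norm_minus_commute)
        hence "B * norm y \<le> B * (norm x + 1)" using B by (rule mult_left_mono)
        thus "ereal (- A - B * (norm x + 1)) \<le> (if y \<in> S (r n) i then ereal (\<phi> (r n) i y) else \<infinity>)"
          using elim by fastforce
      qed
    qed
    hence "ereal (- A - B * (norm x + 1)) \<le> a (i, k)"
      using a by (intro tendsto_lowerbound[OF a]) auto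
    thus ?thesis using a_le[OF k(1), of i] by auto
  qed
  have c_open: "open {Y. t < c Y}" "open {Y. c Y < t}" for t
    using cont by (auto intro!: open_Collect_less continuous_intros)
  have ge: "ereal (c X) \<le> (\<Sum>i\<in>UNIV. \<Phi> i (X $ i))" for X
  proof (rule ccontr)
    assume "\<not> ?thesis"
    hence less: "(\<Sum>i\<in>UNIV. \<Phi> i (X $ i)) < ereal (c X)" by simp
    define v where "v = (\<lambda>i. real_of_ereal (\<Phi> i (X $ i)))"
    have "\<Phi> i (X $ i) \<noteq> \<infinity>" for i
      using less sum_Pinfty[of "\<lambda>i. \<Phi> i (X $ i)" UNIV] by auto
    hence v: "\<Phi> i (X $ i) = ereal (v i)" for i
      using neq[of i "X $ i"] by (cases "\<Phi> i (X $ i)") (auto simp: v_def)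
    \<comment> \<open>Half the supposed gap: one half pays for the errors \<open>d\<close> of the
      near-minimisers, the other for the variation of \<open>c\<close> near
      \<open>X\<close>.\<close>
    define e where "e = (c X - sum v UNIV) / 2"
    have e: "e > 0" using less by (simp add: v e_def)
    define d where "d = e / CARD('d)"
    have d: "d > 0" using e by (simp add: d_def)
    have "\<exists>W. (\<forall>i. open (W i) \<and> X $ i \<in> W i) \<and> (\<forall>Y. (\<forall>i. Y $ i \<in> W i) \<longrightarrow> Y \<in> {Y. c X - e < c Y})"
      by (rule c_open(1)[of "c X - e", unfolded open_vec_def, rule_format]) (use e in simp)
    then obtain W where W: "\<forall>i. open (W i) \<and> X $ i \<in> W i"
      "\<forall>Y. (\<forall>i. Y $ i \<in> W i) \<longrightarrow> Y \<in> {Y. c X - e < c Y}" by (elim exE conjE)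
    have "\<exists>k. \<forall>i. X $ i \<in> U (k i) \<and> U (k i) \<subseteq> W i"
      using W(1) U by (intro choice allI) blast
    then obtain k where k: "\<And>i. X $ i \<in> U (k i)" "\<And>i. U (k i) \<subseteq> W i" by blast
    have "\<forall>\<^sub>F n in sequentially. f (r n) (i, k i) < ereal (v i + d)" for i
    proof (rule order_tendstoD(2)[OF a])
      have "a (i, k i) \<le> ereal (v i)" using a_le[OF k(1), of i i] unfolding v .
      also have "\<dots> < ereal (v i + d)" using d by simp
      finally show "a (i, k i) < ereal (v i + d)" .
    qed
    hence "\<forall>\<^sub>F n in sequentially. \<forall>i. f (r n) (i, k i) < ereal (v i + d)"
      by (rule eventually_all_finite)
    then obtain n where n: "\<And>i. f (r n) (i, k i) < ereal (v i + d)"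
      using eventually_happens'[OF sequentially_bot] by blast
    have "\<exists>y. \<forall>i. y i \<in> U (k i) \<and> y i \<in> S (r n) i \<and> \<phi> (r n) i (y i) < v i + d"
    proof (intro choice allI)
      fix i
      obtain y where "y \<in> U (k i)" "(if y \<in> S (r n) i then ereal (\<phi> (r n) i y) else \<infinity>) < ereal (v i + d)"
        using n[of i] unfolding f_def prod.case INF_less_iff by blast
      thus "\<exists>y. y \<in> U (k i) \<and> y \<in> S (r n) i \<and> \<phi> (r n) i y < v i + d"
        by (intro exI[of _ y]) (auto split: if_splits)
    qed
    then obtain y where y: "\<And>i. y i \<in> U (k i)" "\<And>i. y i \<in> S (r n) i" "\<And>i. \<phi> (r n) i (y i) < v i + d"
      by blast
    let ?Y = "\<chi> i. y i"
    have "c ?Y \<le> (\<Sum>i\<in>UNIV. \<phi> (r n) i (?Y $ i))" by (rule adm) (simp add: y)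
    also have "\<dots> \<le> (\<Sum>i\<in>UNIV. v i + d)" using y(3) by (intro sum_mono) (auto intro: less_imp_le)
    also have "\<dots> = sum v UNIV + e" by (simp add: sum.distrib d_def)
    also have "\<dots> = c X - e" by (simp add: e_def field_simps)
    also have "\<dots> < c ?Y"
    proof -
      have "\<forall>i. ?Y $ i \<in> W i" using y(1) k(2) by auto
      thus ?thesis using W(2) by blast
    qed
    finally show False by simp
  qed
  have le: "(\<Sum>i\<in>UNIV. \<Phi> i (X $ i)) \<le> ereal (c X)" if X: "X \<in> \<Gamma>" for X
  proof (rule ccontr)
    assume "\<not> ?thesis"
    hence "ereal (c X) < (\<Sum>i\<in>UNIV. \<Phi> i (X $ i))" by simp
    then obtain b where b: "\<And>i. ereal (b i) < \<Phi> i (X $ i)" "c X < sum b UNIV"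
      using ereal_less_sum_split[of UNIV "c X" "\<lambda>i. \<Phi> i (X $ i)"] neq by auto
    \<comment> \<open>Again half the gap: one half is the slack allowed at \<open>Y\<close>, the
      other the variation of \<open>c\<close>.\<close>
    define e where "e = (sum b UNIV - c X) / 2"
    have e: "e > 0" using b(2) by (simp add: e_def)
    have "\<exists>k. \<forall>i. X $ i \<in> U (k i) \<and> ereal (b i) < a (i, k i)"
      using b(1) unfolding \<Phi>_def less_SUP_iff by (intro choice allI) blast
    then obtain k where k: "\<And>i. X $ i \<in> U (k i)" "\<And>i. ereal (b i) < a (i, k i)" by blast
    let ?V = "{Y. \<forall>i. Y $ i \<in> U (k i)} \<inter> {Y. c Y < c X + e}"
    have "open {Y :: 'a ^ 'd. \<forall>i. Y $ i \<in> U (k i)}"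
      by (intro open_vector_box allI U_open)
    hence "open ?V" using c_open(2) by (rule open_Int)
    moreover have "X \<in> ?V" using k(1) e by simp
    ultimately have "\<forall>\<^sub>F n in sequentially. \<exists>Y\<in>?V. (\<forall>i. Y $ i \<in> S (r n) i) \<and>
        (\<Sum>i\<in>UNIV. \<phi> (r n) i (Y $ i)) \<le> c Y + e"
      by (rule eventually_subseq[OF r slack[OF X _ _ e]])
    moreover have "\<forall>\<^sub>F n in sequentially. \<forall>i. ereal (b i) < f (r n) (i, k i)"
      by (rule eventually_all_finite) (rule order_tendstoD(1)[OF a k(2)])
    ultimately have "\<forall>\<^sub>F n in sequentially. False"
    proof eventually_elim
      case (elim n)
      then obtain Y where Y: "Y \<in> ?V" "\<And>i. Y $ i \<in> S (r n) i"
        "(\<Sum>i\<in>UNIV. \<phi> (r n) i (Y $ i)) \<le> c Y + e" by blast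
      have "b i \<le> \<phi> (r n) i (Y $ i)" for i
      proof -
        have "ereal (b i) < f (r n) (i, k i)" using elim by blast
        also have "\<dots> \<le> (if Y $ i \<in> S (r n) i then ereal (\<phi> (r n) i (Y $ i)) else \<infinity>)"
          unfolding f_def prod.case by (rule INF_lower) (use Y(1) in auto)
        finally show ?thesis using Y(2)[of i] by simp
      qed
      hence "sum b UNIV \<le> (\<Sum>i\<in>UNIV. \<phi> (r n) i (Y $ i))" by (rule sum_mono)
      also have "\<dots> \<le> c Y + e" by (rule Y(3))
      also have "\<dots> < c X + e + e" using Y(1) by simp
      also have "\<dots> = sum b UNIV" by (simp add: e_def field_simps)
      finally show False by simp
    qed
    thus False by simp
  qed
  show ?thesis
    by (intro exI[of _ \<Phi>] conjI allI ballI lsc neq ge antisym le)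
qed

section \<open>Proof of the duality theorem\<close>

lemma finite_duality_vec:
  fixes S :: "'d::finite \<Rightarrow> 'a set" and m :: "'d \<Rightarrow> 'a \<Rightarrow> real" and c :: "'a ^ 'd \<Rightarrow> real"
  assumes fin: "\<And>i. finite (S i)"
    and pos: "\<And>i a. a \<in> S i \<Longrightarrow> m i a > 0"
    and sum1: "\<And>i. (\<Sum>a\<in>S i. m i a) = 1"
    and e: "e > 0"
  defines "F \<equiv> {X. \<forall>i. X $ i \<in> S i}"
  shows "\<exists>g \<phi>. finite F \<and> (\<forall>X\<in>F. g X > 0) \<and>
    (\<forall>i. \<forall>a\<in>S i. (\<Sum>X\<in>{X\<in>F. X $ i = a}. g X) = m i a) \<and>
    (\<forall>X\<in>F. c X \<le> (\<Sum>i\<in>UNIV. \<phi> i (X $ i))) \<and>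
    (\<Sum>X\<in>F. g X * ((\<Sum>i\<in>UNIV. \<phi> i (X $ i)) - c X)) \<le> e"
proof -
  let ?P = "PiE UNIV S"
  have "\<exists>g \<phi>. (\<forall>x\<in>?P. g x > 0) \<and>
    (\<forall>i. \<forall>a\<in>S i. (\<Sum>x\<in>{x\<in>?P. x i = a}. g x) = m i a) \<and>
    (\<forall>x\<in>?P. c (vec_lambda x) \<le> (\<Sum>i\<in>UNIV. \<phi> i (x i))) \<and>
    (\<Sum>x\<in>?P. g x * ((\<Sum>i\<in>UNIV. \<phi> i (x i)) - c (vec_lambda x))) \<le> e"
    by (rule finite_duality[OF fin pos sum1 e])
  then obtain g \<phi> where g: "\<forall>x\<in>?P. g x > 0"
    "\<forall>i. \<forall>a\<in>S i. (\<Sum>x\<in>{x\<in>?P. x i = a}. g x) = m i a"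
    "\<forall>x\<in>?P. c (vec_lambda x) \<le> (\<Sum>i\<in>UNIV. \<phi> i (x i))"
    "(\<Sum>x\<in>?P. g x * ((\<Sum>i\<in>UNIV. \<phi> i (x i)) - c (vec_lambda x))) \<le> e"
    by (elim exE conjE)
  have inj: "inj_on vec_lambda A" for A :: "('d \<Rightarrow> 'a) set"
    by (rule inj_onI) (simp add: vec_lambda_inject)
  have F: "F = vec_lambda ` ?P"
  proof (intro set_eqI iffI)
    fix X assume "X \<in> F"
    hence "vec_nth X \<in> ?P" by (auto simp: F_def)
    thus "X \<in> vec_lambda ` ?P" by (intro image_eqI[of _ _ "vec_nth X"]) auto
  qed (auto simp: F_def)
  have Fi: "{X\<in>F. X $ i = a} = vec_lambda ` {x\<in>?P. x i = a}" for i a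
    unfolding F by auto
  show ?thesis
  proof (intro exI[of _ "\<lambda>X. g (vec_nth X)"] exI[of _ \<phi>] conjI ballI allI)
    show "finite F" unfolding F by (intro finite_imageI finite_PiE fin) auto
    show "(\<Sum>X\<in>{X\<in>F. X $ i = a}. g (vec_nth X)) = m i a" if "a \<in> S i" for i a
      unfolding Fi using g(2) that by (simp add: sum.reindex[OF inj] vec_lambda_inverse)
    show "(\<Sum>X\<in>F. g (vec_nth X) * ((\<Sum>i\<in>UNIV. \<phi> i (X $ i)) - c X)) \<le> e"
      unfolding F using g(4) by (simp add: sum.reindex[OF inj] vec_lambda_inverse)
    show "g (vec_nth X) > 0" if "X \<in> F" for X using that g(1) by (auto simp: F vec_lambda_inverse)
    show "c X \<le> (\<Sum>i\<in>UNIV. \<phi> i (X $ i))" if "X \<in> F" for X using that g(3) by (auto simp: F)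
  qed
qed

lemma cell_code_mono: "N \<le> n \<Longrightarrow> cell_code N x = cell_code n x \<inter> {..<N}"
  by (auto simp: cell_code_def)

lemma cell_code_eq_mono: "cell_code n y = cell_code n x \<Longrightarrow> N \<le> n \<Longrightarrow> cell_code N y = cell_code N x"
  by (simp add: cell_code_mono)

text \<open>Each coordinate of \<open>x\<close> is bracketed by rational thresholds at distance less
  than \<open>d\<close> on both sides. Finitely many half-spaces do this, so some depth contains
  them all; the l1 bound of the norm explains \<open>d = e / (2 * CARD('d))\<close>.\<close>

lemma cell_code_shrink:
  fixes x :: "real ^ 'd::finite"
  assumes "open A" "x \<in> A"
  shows "\<exists>N. \<forall>y. cell_code N y = cell_code N x \<longrightarrow> y \<in> A"
proof -
  obtain e where e: "e > 0" "ball x e \<subseteq> A" using assms open_contains_ball by blast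
  define d where "d = e / (2 * CARD('d))"
  have d: "d > 0" using e by (simp add: d_def)
  have "\<exists>a. \<forall>j. x $ j - d < of_rat (a j) \<and> of_rat (a j) < x $ j"
    using d by (intro choice allI of_rat_dense) simp
  then obtain a where a: "\<And>j. x $ j - d < of_rat (a j)" "\<And>j. of_rat (a j) < x $ j" by blast
  have "\<exists>b. \<forall>j. x $ j < of_rat (b j) \<and> of_rat (b j) < x $ j + d"
    using d by (intro choice allI of_rat_dense) simp
  then obtain b where b: "\<And>j. x $ j < of_rat (b j)" "\<And>j. of_rat (b j) < x $ j + d" by blast
  define N where "N = Suc (Max (range (\<lambda>j. max (to_nat (j, a j)) (to_nat (j, b j)))))"
  have "max (to_nat (j, a j)) (to_nat (j, b j)) < N" for j
    unfolding N_def less_Suc_eq_le by (rule Max_ge) auto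
  hence N: "to_nat (j, a j) < N" "to_nat (j, b j) < N" for j by (simp_all add: max_less_iff_conj)
  have "y \<in> A" if y: "cell_code N y = cell_code N x" for y
  proof -
    have eq: "y \<in> halfspace k \<longleftrightarrow> x \<in> halfspace k" if "k < N" for k
      using y that unfolding cell_code_def by blast
    have "\<bar>(x - y) $ j\<bar> \<le> d" for j
      using eq[OF N(1)[of j]] eq[OF N(2)[of j]] a[of j] b[of j] by auto
    hence "(\<Sum>j\<in>UNIV. \<bar>(x - y) $ j\<bar>) \<le> (\<Sum>j\<in>(UNIV :: 'd set). d)" by (rule sum_mono)
    also have "\<dots> = e / 2" by (simp add: d_def)
    also have "\<dots> < e" using e by simp
    finally have "norm (x - y) < e" using norm_le_l1_cart[of "x - y"] by linarith
    thus "y \<in> A" using e(2) by (auto simp: dist_norm)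
  qed
  thus ?thesis by blast
qed

lemma cell_code_shrink_rows:
  fixes X :: "real ^ 'd::finite ^ 'd"
  assumes "open V" "X \<in> V"
  shows "\<exists>N. \<forall>Y. (\<forall>i. cell_code N (Y $ i) = cell_code N (X $ i)) \<longrightarrow> Y \<in> V"
proof -
  have "\<exists>W. (\<forall>i. open (W i) \<and> X $ i \<in> W i) \<and> (\<forall>Y. (\<forall>i. Y $ i \<in> W i) \<longrightarrow> Y \<in> V)"
    using assms unfolding open_vec_def by blast
  then obtain W where W: "\<forall>i. open (W i) \<and> X $ i \<in> W i" "\<forall>Y. (\<forall>i. Y $ i \<in> W i) \<longrightarrow> Y \<in> V"
    by (elim exE conjE)
  have "\<exists>N. \<forall>i y. cell_code (N i) y = cell_code (N i) (X $ i) \<longrightarrow> y \<in> W i"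
    using W(1) cell_code_shrink by (intro choice allI) blast
  then obtain N where N: "\<forall>i y. cell_code (N i) y = cell_code (N i) (X $ i) \<longrightarrow> y \<in> W i" by (elim exE)
  have "N i \<le> Max (range N)" for i by (rule Max_ge) auto
  hence "Y \<in> V" if "\<forall>i. cell_code (Max (range N)) (Y $ i) = cell_code (Max (range N)) (X $ i)" for Y
    using that N W(2) cell_code_eq_mono[of "Max (range N)" "Y $ i" "X $ i" "N i" for i] by simp
  thus ?thesis by blast
qed

text \<open>Shifting by constants with sum zero leaves all sums unchanged and equalises the values
  at the rows of \<open>Y\<close>. Replacing one row of \<open>Y\<close> in the admissibility
  inequality then gives a lower bound in terms of \<open>R\<close> alone, whatever the potentials
  were.\<close>

lemma normalized_potentials:
  fixes S :: "'d::finite \<Rightarrow> (real ^ 'd) set" and \<phi> :: "'d \<Rightarrow> real ^ 'd \<Rightarrow> real"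
  assumes adm: "\<And>X. (\<And>i. X $ i \<in> S i) \<Longrightarrow> det_cols X \<le> (\<Sum>i\<in>UNIV. \<phi> i (X $ i))"
    and Y: "\<And>i. Y $ i \<in> S i" "\<And>i. norm (Y $ i) \<le> R i"
    and slack: "(\<Sum>i\<in>UNIV. \<phi> i (Y $ i)) \<le> det_cols Y + 1"
  shows "\<exists>\<psi>. (\<forall>X :: real ^ 'd ^ 'd. (\<Sum>i\<in>UNIV. \<psi> i (X $ i)) = (\<Sum>i\<in>UNIV. \<phi> i (X $ i))) \<and>
    (\<forall>i. \<forall>y\<in>S i. - (fact CARD('d) * (\<Prod>i\<in>UNIV. R i) + 1)
        - fact CARD('d) * (\<Prod>i\<in>UNIV. 1 + R i) * norm y \<le> \<psi> i y)"
proof -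
  define T where "T = (\<Sum>i\<in>UNIV. \<phi> i (Y $ i))"
  define N where "N = real CARD('d)"
  have N: "N \<ge> 1" unfolding N_def using zero_less_card_finite[where 'a = 'd] by linarith
  \<comment> \<open>Each \<open>\<psi> i\<close> takes the value \<open>T / N\<close> at
    \<open>Y $ i\<close>, and admissibility together with the slack bound puts \<open>T\<close>
    within 1 of the determinant of \<open>Y\<close>.\<close>
  define \<psi> where "\<psi> = (\<lambda>i y. \<phi> i y - \<phi> i (Y $ i) + T / N)"
  have sum_eq: "(\<Sum>i\<in>UNIV. \<psi> i (X $ i)) = (\<Sum>i\<in>UNIV. \<phi> i (X $ i))" for X
    using N by (simp add: \<psi>_def sum.distrib sum_subtractf T_def[symmetric] N_def[symmetric])
  have "(\<Prod>i\<in>UNIV. norm (Y $ i)) \<le> (\<Prod>i\<in>UNIV. R i)"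
    using Y(2) by (intro prod_mono) auto
  hence "fact CARD('d) * (\<Prod>i\<in>UNIV. norm (Y $ i)) \<le> fact CARD('d) * (\<Prod>i\<in>UNIV. R i)"
    by (rule mult_left_mono) auto
  hence "\<bar>det_cols Y\<bar> \<le> fact CARD('d) * (\<Prod>i\<in>UNIV. R i)"
    using abs_det_cols_le[of Y] by linarith
  moreover have "det_cols Y \<le> T" unfolding T_def by (rule adm) (rule Y)
  ultimately have T: "\<bar>T\<bar> \<le> fact CARD('d) * (\<Prod>i\<in>UNIV. R i) + 1"
    using slack unfolding T_def by linarith
  have "- (fact CARD('d) * (\<Prod>i\<in>UNIV. R i) + 1) - fact CARD('d) * (\<Prod>i\<in>UNIV. 1 + R i) * norm y \<le> \<psi> i y"
    if y: "y \<in> S i" for i y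
  proof -
    let ?Z = "subst_row i y Y"
    have "det_cols ?Z \<le> (\<Sum>j\<in>UNIV. \<psi> j (?Z $ j))"
      unfolding sum_eq by (rule adm) (use Y y in auto)
    also have "\<dots> = \<psi> i y + (\<Sum>j\<in>UNIV-{i}. \<psi> j (?Z $ j))"
      by (subst sum.remove[of _ i]) auto
    also have "(\<Sum>j\<in>UNIV-{i}. \<psi> j (?Z $ j)) = (\<Sum>j\<in>UNIV-{i}. T / N)"
      by (intro sum.cong) (auto simp: \<psi>_def)
    also have "\<dots> = (N - 1) / N * T"
      by (simp add: N_def card_Diff_singleton of_nat_diff)
    finally have "det_cols ?Z - (N - 1) / N * T \<le> \<psi> i y" by simp
    moreover have "(N - 1) / N * T \<le> \<bar>T\<bar>"
    proof -
      have "(N - 1) / N * T \<le> (N - 1) / N * \<bar>T\<bar>" using N by (intro mult_left_mono) auto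
      also have "\<dots> \<le> 1 * \<bar>T\<bar>" using N by (intro mult_right_mono) auto
      finally show ?thesis by simp
    qed
    moreover have "\<bar>det_cols ?Z\<bar> \<le> fact CARD('d) * (\<Prod>i\<in>UNIV. 1 + R i) * norm y"
    proof -
      have "(\<Prod>j\<in>UNIV. 1 + norm (Y $ j)) \<le> (\<Prod>i\<in>UNIV. 1 + R i)"
        using Y(2) by (intro prod_mono) (auto simp: add_nonneg_nonneg)
      hence "fact CARD('d) * (\<Prod>j\<in>UNIV. 1 + norm (Y $ j)) * norm y \<le> fact CARD('d) * (\<Prod>i\<in>UNIV. 1 + R i) * norm y"
        by (intro mult_left_mono mult_right_mono) auto
      thus ?thesis using abs_det_cols_subst_row_le[of i y Y] by linarith
    qed
    ultimately show ?thesis using T by linarith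
  qed
  thus ?thesis using sum_eq by blast
qed

text \<open>Each depth has finitely many cells, so the union of all null cells is null. The
  remaining points stand in for the support of \<gamma>.\<close>

lemma AE_positive_cell:
  fixes \<gamma> :: "(real ^ 'd::finite ^ 'd) measure"
  assumes "prob_space \<gamma>" and sets: "sets \<gamma> = sets borel"
  shows "AE X in \<gamma>. \<forall>N. measure \<gamma> {Y. \<forall>i. cell_code N (Y $ i) = cell_code N (X $ i)} > 0"
proof -
  interpret prob_space \<gamma> by fact
  let ?C = "\<lambda>N T. {Y :: real ^ 'd ^ 'd. \<forall>i. cell_code N (Y $ i) = T i}"
  let ?T = "\<lambda>N. PiE (UNIV :: 'd set) (\<lambda>_. range (cell_code N :: real ^ 'd \<Rightarrow> nat set))"
  have C: "?C N T \<in> sets \<gamma>" for N T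
  proof -
    have "(\<lambda>X. X $ i) \<in> borel_measurable (borel :: (real ^ 'd ^ 'd) measure)" for i
      by (intro borel_measurable_continuous_onI continuous_intros)
    from measurable_sets[OF this sets_cell_code]
    have "{X. cell_code N (X $ i) = T i} \<in> sets (borel :: (real ^ 'd ^ 'd) measure)" for i
      by (simp add: vimage_def)
    hence "{Y\<in>space borel. \<forall>i. cell_code N (Y $ i) = T i} \<in> sets (borel :: (real ^ 'd ^ 'd) measure)"
      by (intro sets.sets_Collect) auto
    thus ?thesis by (simp add: sets)
  qed
  have "AE X in \<gamma>. \<forall>N. \<forall>T\<in>?T N. measure \<gamma> (?C N T) = 0 \<longrightarrow> X \<notin> ?C N T"
  proof (subst AE_all_countable, intro allI)
    fix N
    have cnt: "countable (?T N)"
      by (intro countable_finite finite_PiE finite_range_cell_code) auto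
    show "AE X in \<gamma>. \<forall>T\<in>?T N. measure \<gamma> (?C N T) = 0 \<longrightarrow> X \<notin> ?C N T"
    proof (rule iffD2[OF AE_ball_countable[OF cnt]], intro ballI)
      fix T
      show "AE X in \<gamma>. measure \<gamma> (?C N T) = 0 \<longrightarrow> X \<notin> ?C N T"
      proof (cases "measure \<gamma> (?C N T) = 0")
        case True
        hence "?C N T \<in> null_sets \<gamma>"
          using C by (auto simp: null_sets_def emeasure_eq_measure)
        from AE_not_in[OF this] show ?thesis by eventually_elim simp
      qed auto
    qed
  qed
  thus ?thesis
  proof eventually_elim
    case (elim X)
    show ?case
    proof
      fix N
      have "(\<lambda>i. cell_code N (X $ i)) \<in> ?T N" by auto
      from bspec[OF spec[OF elim, of N] this]
      have "measure \<gamma> (?C N (\<lambda>i. cell_code N (X $ i))) \<noteq> 0" by simp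
      thus "measure \<gamma> (?C N (\<lambda>i. cell_code N (X $ i))) > 0"
        using measure_nonneg[of \<gamma>] by (simp add: less_le)
    qed
  qed
qed

text \<open>Each marginal is concentrated on one representative per cell of depth \<open>n\<close>,
  carrying the mass of the cell. A coarser cell is a union of such cells, so its mass is reproduced
  exactly.\<close>

lemma ex_discrete_duality:
  fixes \<mu> :: "'d::finite \<Rightarrow> (real ^ 'd) measure"
  assumes prob: "\<And>i. prob_space (\<mu> i)" and borel: "\<And>i. sets (\<mu> i) = sets borel" and e: "e > 0"
  shows "\<exists>S g \<phi>. finite {X. \<forall>i. X $ i \<in> S i} \<and>
    (\<forall>X\<in>{X. \<forall>i. X $ i \<in> S i}. g X \<ge> 0) \<and>
    (\<forall>N\<le>n. \<forall>i Q. (\<Sum>X\<in>{X\<in>{X. \<forall>i. X $ i \<in> S i}. Q (cell_code N (X $ i))}. g X)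
        = measure (\<mu> i) {x. Q (cell_code N x)}) \<and>
    (\<forall>X\<in>{X. \<forall>i. X $ i \<in> S i}. det_cols X \<le> (\<Sum>i\<in>UNIV. \<phi> i (X $ i))) \<and>
    (\<Sum>X\<in>{X. \<forall>i. X $ i \<in> S i}. g X * ((\<Sum>i\<in>UNIV. \<phi> i (X $ i)) - det_cols X)) \<le> e"
proof -
  define mass where "mass = (\<lambda>i u. measure (\<mu> i) {x. cell_code n x = u})"
  \<comment> \<open>Null cells are dropped because \<open>finite_duality_vec\<close> asks for
    positive masses.\<close>
  define C where "C = (\<lambda>i. {u \<in> range (cell_code n :: real ^ 'd \<Rightarrow> _). mass i u > 0})"
  define rep where "rep = (\<lambda>u. SOME x :: real ^ 'd. cell_code n x = u)"
  have rep: "cell_code n (rep u) = u" if "u \<in> range (cell_code n :: real ^ 'd \<Rightarrow> _)" for u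
    unfolding rep_def by (rule someI_ex) (use that in auto)
  have repC: "cell_code n (rep u) = u" if "u \<in> C i" for u i
    using that rep by (simp add: C_def)
  define S where "S = (\<lambda>i. rep ` C i)"
  have finC: "finite (C i)" for i
    unfolding C_def by (rule finite_subset[OF _ finite_range_cell_code[of n]]) auto
  have finS: "finite (S i)" for i unfolding S_def using finC by simp
  have inj: "inj_on rep (C i)" for i using repC by (metis inj_onI)
  have mass_sum: "measure (\<mu> i) {x. Q (cell_code n x)} = (\<Sum>u\<in>{u\<in>C i. Q u}. mass i u)" for i Q
  proof -
    interpret prob_space "\<mu> i" by (rule prob)
    let ?U = "{u \<in> range (cell_code n :: real ^ 'd \<Rightarrow> _). Q u}"
    have finU: "finite ?U"
      by (rule finite_subset[OF _ finite_range_cell_code[of n]]) auto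
    have "{x :: real ^ 'd. Q (cell_code n x)} = (\<Union>u\<in>?U. {x. cell_code n x = u})" by auto
    also have "measure (\<mu> i) \<dots> = (\<Sum>u\<in>?U. mass i u)"
      unfolding mass_def
    proof (rule finite_measure_finite_Union[OF finU])
      show "(\<lambda>u. {x. cell_code n x = u}) ` ?U \<subseteq> events"
        using sets_cell_code[of "\<lambda>v. v = u" n for u] by (auto simp: borel)
    qed (auto simp: disjoint_family_on_def)
    also have "\<dots> = (\<Sum>u\<in>{u\<in>C i. Q u}. mass i u)"
      by (rule sum.mono_neutral_right[OF finU])
         (auto simp: C_def mass_def zero_less_measure_iff)
    finally show ?thesis .
  qed
  have sumS: "(\<Sum>a\<in>{a\<in>S i. Q (cell_code n a)}. mass i (cell_code n a)) = measure (\<mu> i) {x. Q (cell_code n x)}" for i Q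
  proof -
    have "{a\<in>S i. Q (cell_code n a)} = rep ` {u\<in>C i. Q u}"
      unfolding S_def using repC by auto
    moreover have "inj_on rep {u\<in>C i. Q u}" using inj by (rule inj_on_subset) auto
    ultimately have "(\<Sum>a\<in>{a\<in>S i. Q (cell_code n a)}. mass i (cell_code n a)) =
        (\<Sum>u\<in>{u\<in>C i. Q u}. mass i (cell_code n (rep u)))"
      by (simp add: sum.reindex)
    also have "\<dots> = (\<Sum>u\<in>{u\<in>C i. Q u}. mass i u)"
      by (intro sum.cong refl) (auto simp: repC)
    finally show ?thesis by (simp add: mass_sum)
  qed
  have pos: "mass i (cell_code n a) > 0" if "a \<in> S i" for i a
    using that repC unfolding S_def by (auto simp: C_def)
  have one: "(\<Sum>a\<in>S i. mass i (cell_code n a)) = 1" for i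
  proof -
    interpret prob_space "\<mu> i" by (rule prob)
    have "(UNIV :: (real ^ 'd) set) = space (\<mu> i)" using sets_eq_imp_space_eq[OF borel[of i]] by simp
    thus ?thesis using sumS[of i "\<lambda>_. True"] prob_space by simp
  qed
  let ?F = "{X. \<forall>i. X $ i \<in> S i}"
  have "\<exists>g \<phi>. finite ?F \<and> (\<forall>X\<in>?F. g X > 0) \<and>
    (\<forall>i. \<forall>a\<in>S i. (\<Sum>X\<in>{X\<in>?F. X $ i = a}. g X) = mass i (cell_code n a)) \<and>
    (\<forall>X\<in>?F. det_cols X \<le> (\<Sum>i\<in>UNIV. \<phi> i (X $ i))) \<and>
    (\<Sum>X\<in>?F. g X * ((\<Sum>i\<in>UNIV. \<phi> i (X $ i)) - det_cols X)) \<le> e"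
    by (rule finite_duality_vec[OF finS pos one e])
  then obtain g \<phi> where g: "finite ?F" "\<forall>X\<in>?F. g X > 0"
    "\<forall>i. \<forall>a\<in>S i. (\<Sum>X\<in>{X\<in>?F. X $ i = a}. g X) = mass i (cell_code n a)"
    "\<forall>X\<in>?F. det_cols X \<le> (\<Sum>i\<in>UNIV. \<phi> i (X $ i))"
    "(\<Sum>X\<in>?F. g X * ((\<Sum>i\<in>UNIV. \<phi> i (X $ i)) - det_cols X)) \<le> e" by (elim exE conjE)
  have marg: "(\<Sum>X\<in>{X\<in>?F. Q (cell_code N (X $ i))}. g X) = measure (\<mu> i) {x. Q (cell_code N x)}"
    if N: "N \<le> n" for N i Q
  proof -
    \<comment> \<open>The code of depth \<open>N\<close> is a truncation of the code of depth
      \<open>n\<close>, which turns a predicate on the former into one on the latter.\<close>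
    let ?Q = "\<lambda>u. Q (u \<inter> {..<N})"
    have Q: "Q (cell_code N x) \<longleftrightarrow> ?Q (cell_code n x)" for x :: "real ^ 'd"
      using cell_code_mono[OF N, of x] by simp
    let ?A = "{a\<in>S i. ?Q (cell_code n a)}"
    have "{X\<in>?F. Q (cell_code N (X $ i))} = (\<Union>a\<in>?A. {X\<in>?F. X $ i = a})"
      using Q by auto
    also have "sum g \<dots> = (\<Sum>a\<in>?A. \<Sum>X\<in>{X\<in>?F. X $ i = a}. g X)"
      by (rule sum.UNION_disjoint) (use finS g(1) in auto)
    also have "\<dots> = (\<Sum>a\<in>?A. mass i (cell_code n a))"
      by (intro sum.cong refl) (use g(3) in auto)
    also have "\<dots> = measure (\<mu> i) {x. ?Q (cell_code n x)}" by (rule sumS)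
    finally show ?thesis by (simp only: Q)
  qed
  show ?thesis
    by (intro exI[of _ S] exI[of _ g] exI[of _ \<phi>] conjI allI impI g(1) g(4) g(5) marg)
       (use g(2) in \<open>auto intro: less_imp_le\<close>)
qed

text \<open>Discrete problems with total slack at most \<open>1 / Suc n\<close> are passed to the
  limit, couplings first: a point charged by the limit coupling is needed to locate atoms of bounded
  norm at which the potentials are normalised.\<close>

lemma ex_coupling_potentials:
  fixes \<mu> :: "'d::finite \<Rightarrow> (real ^ 'd) measure"
  assumes prob: "\<And>i. prob_space (\<mu> i)" and borel: "\<And>i. sets (\<mu> i) = sets borel"
  shows "\<exists>\<gamma>\<in>couplings \<mu>. \<exists>\<Phi>\<in>dual_admissible. AE X in \<gamma>. (\<Sum>i\<in>UNIV. \<Phi> i (X $ i)) = ereal (det_cols X)"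
proof -
  let ?F = "\<lambda>S :: 'd \<Rightarrow> (real ^ 'd) set. {X. \<forall>i. X $ i \<in> S i}"
  have "\<exists>t. \<forall>n. case t n of (S, g, \<phi>) \<Rightarrow> finite (?F S) \<and> (\<forall>X\<in>?F S. g X \<ge> 0) \<and>
    (\<forall>N\<le>n. \<forall>i Q. (\<Sum>X\<in>{X\<in>?F S. Q (cell_code N (X $ i))}. g X) = measure (\<mu> i) {x. Q (cell_code N x)}) \<and>
    (\<forall>X\<in>?F S. det_cols X \<le> (\<Sum>i\<in>UNIV. \<phi> i (X $ i))) \<and>
    (\<Sum>X\<in>?F S. g X * ((\<Sum>i\<in>UNIV. \<phi> i (X $ i)) - det_cols X)) \<le> 1 / Suc n"
  proof (intro choice allI)
    fix n
    have "1 / real (Suc n) > 0" by simp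
    from ex_discrete_duality[where \<mu> = \<mu> and n = n, OF prob borel this]
    show "\<exists>t. case t of (S, g, \<phi>) \<Rightarrow> finite (?F S) \<and> (\<forall>X\<in>?F S. g X \<ge> 0) \<and>
    (\<forall>N\<le>n. \<forall>i Q. (\<Sum>X\<in>{X\<in>?F S. Q (cell_code N (X $ i))}. g X) = measure (\<mu> i) {x. Q (cell_code N x)}) \<and>
    (\<forall>X\<in>?F S. det_cols X \<le> (\<Sum>i\<in>UNIV. \<phi> i (X $ i))) \<and>
    (\<Sum>X\<in>?F S. g X * ((\<Sum>i\<in>UNIV. \<phi> i (X $ i)) - det_cols X)) \<le> 1 / Suc n"
      unfolding split_paired_Ex prod.case .
  qed
  then obtain t where t: "\<forall>n. case t n of (S, g, \<phi>) \<Rightarrow> finite (?F S) \<and> (\<forall>X\<in>?F S. g X \<ge> 0) \<and>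
    (\<forall>N\<le>n. \<forall>i Q. (\<Sum>X\<in>{X\<in>?F S. Q (cell_code N (X $ i))}. g X) = measure (\<mu> i) {x. Q (cell_code N x)}) \<and>
    (\<forall>X\<in>?F S. det_cols X \<le> (\<Sum>i\<in>UNIV. \<phi> i (X $ i))) \<and>
    (\<Sum>X\<in>?F S. g X * ((\<Sum>i\<in>UNIV. \<phi> i (X $ i)) - det_cols X)) \<le> 1 / Suc n" by (elim exE)
  define S where "S = (\<lambda>n. fst (t n))"
  define g where "g = (\<lambda>n. fst (snd (t n)))"
  define \<phi> where "\<phi> = (\<lambda>n. snd (snd (t n)))"
  define F where "F = (\<lambda>n. ?F (S n))"
  have t_eq: "t n = (S n, g n, \<phi> n)" for n by (simp add: S_def g_def \<phi>_def)
  have F_eq: "?F (S n) = F n" for n by (simp add: F_def)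
  note t' = t[rule_format, unfolded t_eq prod.case F_eq]
  have fin: "finite (F n)" for n using t'[of n] by blast
  have nonneg: "g n X \<ge> 0" if "X \<in> F n" for n X using t'[of n] that by blast
  have marg: "(\<Sum>X\<in>{X\<in>F n. Q (cell_code N (X $ i))}. g n X) = measure (\<mu> i) {x. Q (cell_code N x)}"
    if "N \<le> n" for n N i Q using t'[of n] that by blast
  have adm: "det_cols X \<le> (\<Sum>i\<in>UNIV. \<phi> n i (X $ i))" if "X \<in> F n" for n X
    using t'[of n] that by blast
  have gap: "(\<Sum>X\<in>F n. g n X * ((\<Sum>i\<in>UNIV. \<phi> n i (X $ i)) - det_cols X)) \<le> 1 / Suc n" for n
    using t'[of n] by blast
  have sum1: "(\<Sum>X\<in>F n. g n X) = 1" for n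
  proof -
    fix i :: 'd
    interpret prob_space "\<mu> i" by (rule prob)
    have "(UNIV :: (real ^ 'd) set) = space (\<mu> i)" using sets_eq_imp_space_eq[OF borel[of i]] by simp
    thus "(\<Sum>X\<in>F n. g n X) = 1"
      using marg[of 0 n "\<lambda>_. True" i] prob_space by simp
  qed
  obtain \<gamma> r where \<gamma>: "\<gamma> \<in> couplings \<mu>" and r: "strict_mono r" and
    lim: "\<forall>N T. (\<lambda>n. \<Sum>X\<in>{X\<in>F (r n). \<forall>i. cell_code N (X $ i) = T i}. g (r n) X)
        \<longlonglongrightarrow> measure \<gamma> {X. \<forall>i. cell_code N (X $ i) = T i}"
  proof -
    have "\<exists>\<gamma>\<in>couplings \<mu>. \<exists>r. strict_mono r \<and>
     (\<forall>N T. (\<lambda>n. \<Sum>X\<in>{X\<in>F (r n). \<forall>i. cell_code N (X $ i) = T i}. g (r n) X)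
        \<longlonglongrightarrow> measure \<gamma> {X. \<forall>i. cell_code N (X $ i) = T i})"
      by (rule ex_limit_coupling[OF prob borel fin nonneg sum1 marg])
    thus thesis by (elim bexE exE conjE) (rule that)
  qed
  note lim = lim[rule_format]
  have \<gamma>_prob: "prob_space \<gamma>" and \<gamma>_sets: "sets \<gamma> = sets borel"
    using \<gamma> by (auto simp: couplings_def)
  define \<Gamma> where "\<Gamma> = {X :: real ^ 'd ^ 'd. \<forall>N. measure \<gamma> {Y. \<forall>i. cell_code N (Y $ i) = cell_code N (X $ i)} > 0}"
  have AE_\<Gamma>: "AE X in \<gamma>. X \<in> \<Gamma>"
    using AE_positive_cell[OF \<gamma>_prob \<gamma>_sets] by (simp add: \<Gamma>_def)
  \<comment> \<open>Markov's inequality for the slack: a cell of positive limit mass contains atoms of small slack.\<close>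
  have slack: "\<forall>\<^sub>F n in sequentially. \<exists>Y\<in>V. Y \<in> F (r n) \<and> (\<Sum>i\<in>UNIV. \<phi> (r n) i (Y $ i)) \<le> det_cols Y + e"
    if X: "X \<in> \<Gamma>" "open V" "X \<in> V" and e: "e > 0" for X V e
  proof -
    obtain N where N: "\<And>Y. \<forall>i. cell_code N (Y $ i) = cell_code N (X $ i) \<Longrightarrow> Y \<in> V"
      using cell_code_shrink_rows[OF X(2,3)] by blast
    let ?K = "\<lambda>n. {Y\<in>F (r n). \<forall>i. cell_code N (Y $ i) = cell_code N (X $ i)}"
    let ?s = "\<lambda>n Y. (\<Sum>i\<in>UNIV. \<phi> (r n) i (Y $ i)) - det_cols Y"
    define \<beta> where "\<beta> = measure \<gamma> {Y. \<forall>i. cell_code N (Y $ i) = cell_code N (X $ i)}"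
    have \<beta>: "\<beta> > 0" using X(1) by (simp add: \<Gamma>_def \<beta>_def)
    have "(\<lambda>n. \<Sum>Y\<in>?K n. g (r n) Y) \<longlonglongrightarrow> \<beta>"
      unfolding \<beta>_def by (rule lim)
    hence "\<forall>\<^sub>F n in sequentially. \<beta> / 2 < (\<Sum>Y\<in>?K n. g (r n) Y)"
      by (rule order_tendstoD) (use \<beta> in simp)
    moreover have "\<forall>\<^sub>F n in sequentially. 1 / real (Suc n) < e * \<beta> / 2"
      by (rule order_tendstoD(2)[OF LIMSEQ_Suc[OF lim_1_over_n]]) (use e \<beta> in simp)
    ultimately show ?thesis
    proof eventually_elim
      case (elim n)
      have "\<exists>Y\<in>?K n. ?s n Y \<le> e"
      proof (rule ccontr)
        assume "\<not> ?thesis"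
        hence big: "e < ?s n Y" if "Y \<in> ?K n" for Y using that by force
        have "e * (\<beta> / 2) \<le> e * (\<Sum>Y\<in>?K n. g (r n) Y)"
          using elim(1) e by (intro mult_left_mono) auto
        also have "\<dots> = (\<Sum>Y\<in>?K n. g (r n) Y * e)" by (simp add: sum_distrib_left mult.commute)
        also have "\<dots> \<le> (\<Sum>Y\<in>?K n. g (r n) Y * ?s n Y)"
          using big nonneg by (intro sum_mono mult_left_mono) (auto intro: less_imp_le)
        also have "\<dots> \<le> (\<Sum>Y\<in>F (r n). g (r n) Y * ?s n Y)"
          by (rule sum_mono2) (use fin nonneg adm in auto)
        also have "\<dots> \<le> 1 / Suc (r n)" by (rule gap)
        also have "\<dots> \<le> 1 / Suc n"
          using seq_suble[OF r, of n] by (simp add: frac_le)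
        finally show False using elim(2) by simp
      qed
      thus ?case using N by force
    qed
  qed
  interpret \<gamma>: prob_space \<gamma> by (rule \<gamma>_prob)
  have "\<Gamma> \<noteq> {}"
  proof
    assume "\<Gamma> = {}"
    hence "AE X in \<gamma>. False" using AE_\<Gamma> by simp
    thus False by simp
  qed
  then obtain X0 where X0: "X0 \<in> \<Gamma>" by blast
  \<comment> \<open>The added 1 makes the open balls around the origin neighbourhoods of the rows of
    \<open>X0\<close>, so \<open>slack\<close> finds atoms in them.\<close>
  let ?R = "\<lambda>i. norm (X0 $ i) + 1"
  define A where "A = fact CARD('d) * (\<Prod>i\<in>UNIV. ?R i) + 1"
  define B where "B = fact CARD('d) * (\<Prod>i\<in>UNIV. 1 + ?R i)"
  have "B \<ge> 0" unfolding B_def by (intro mult_nonneg_nonneg prod_nonneg) auto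
  \<comment> \<open>Levels with an atom fit for normalisation. They occur eventually; at other
    levels the potentials may stay as they are, since the lower bound is needed only
    eventually.\<close>
  define good where "good = (\<lambda>n. \<exists>Y\<in>{Y. \<forall>i. Y $ i \<in> ball 0 (?R i)}. Y \<in> F (r n) \<and>
      (\<Sum>i\<in>UNIV. \<phi> (r n) i (Y $ i)) \<le> det_cols Y + 1)"
  have good: "\<forall>\<^sub>F n in sequentially. good n"
  proof -
    have "open {Y :: real ^ 'd ^ 'd. \<forall>i. Y $ i \<in> ball 0 (?R i)}"
      by (intro open_vector_box allI open_ball)
    thus ?thesis unfolding good_def by (rule slack[OF X0]) auto
  qed
  have "\<exists>\<psi>. \<forall>n. (\<forall>X :: real ^ 'd ^ 'd. (\<Sum>i\<in>UNIV. \<psi> n i (X $ i)) = (\<Sum>i\<in>UNIV. \<phi> (r n) i (X $ i))) \<and>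
     (good n \<longrightarrow> (\<forall>i. \<forall>y\<in>S (r n) i. - A - B * norm y \<le> \<psi> n i y))"
  proof (intro choice allI)
    fix n
    show "\<exists>\<psi>. (\<forall>X :: real ^ 'd ^ 'd. (\<Sum>i\<in>UNIV. \<psi> i (X $ i)) = (\<Sum>i\<in>UNIV. \<phi> (r n) i (X $ i))) \<and>
     (good n \<longrightarrow> (\<forall>i. \<forall>y\<in>S (r n) i. - A - B * norm y \<le> \<psi> i y))"
    proof (cases "good n")
      case True
      then obtain Y where Y: "\<And>i. norm (Y $ i) \<le> ?R i" "\<And>i. Y $ i \<in> S (r n) i"
        "(\<Sum>i\<in>UNIV. \<phi> (r n) i (Y $ i)) \<le> det_cols Y + 1"
        by (auto simp: good_def F_def intro: less_imp_le)
      have "\<exists>\<psi>. (\<forall>X :: real ^ 'd ^ 'd. (\<Sum>i\<in>UNIV. \<psi> i (X $ i)) = (\<Sum>i\<in>UNIV. \<phi> (r n) i (X $ i))) \<and>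
          (\<forall>i. \<forall>y\<in>S (r n) i. - A - B * norm y \<le> \<psi> i y)"
        unfolding A_def B_def
        by (rule normalized_potentials[OF adm Y(2) Y(1) Y(3)]) (simp add: F_def)
      thus ?thesis by blast
    next
      case False
      thus ?thesis by (intro exI[of _ "\<phi> (r n)"]) simp
    qed
  qed
  then obtain \<psi> where psi: "\<forall>n. (\<forall>X :: real ^ 'd ^ 'd. (\<Sum>i\<in>UNIV. \<psi> n i (X $ i)) = (\<Sum>i\<in>UNIV. \<phi> (r n) i (X $ i))) \<and>
     (good n \<longrightarrow> (\<forall>i. \<forall>y\<in>S (r n) i. - A - B * norm y \<le> \<psi> n i y))" by (elim exE)
  have psi_sum: "(\<Sum>i\<in>UNIV. \<psi> n i (X $ i)) = (\<Sum>i\<in>UNIV. \<phi> (r n) i (X $ i))" for n X using psi by blast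
  have "\<exists>\<Phi>. (\<forall>i. lower_semicontinuous (\<Phi> i)) \<and> (\<forall>i x. \<Phi> i x \<noteq> -\<infinity>) \<and>
     (\<forall>X. ereal (det_cols X) \<le> (\<Sum>i\<in>UNIV. \<Phi> i (X $ i))) \<and>
     (\<forall>X\<in>\<Gamma>. (\<Sum>i\<in>UNIV. \<Phi> i (X $ i)) = ereal (det_cols X))"
  proof (rule ex_epi_limit_potentials[where S = "\<lambda>n. S (r n)" and \<phi> = \<psi>])
    show "continuous_on UNIV (det_cols :: real ^ 'd ^ 'd \<Rightarrow> real)" by (rule continuous_det_cols)
    show "B \<ge> 0" by fact
    show "det_cols X \<le> (\<Sum>i\<in>UNIV. \<psi> n i (X $ i))" if "\<And>i. X $ i \<in> S (r n) i" for n X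
      unfolding psi_sum by (rule adm) (simp add: F_def that)
    show "\<forall>\<^sub>F n in sequentially. \<forall>i. \<forall>y\<in>S (r n) i. - A - B * norm y \<le> \<psi> n i y"
      using good by eventually_elim (use psi in blast)
    show "\<forall>\<^sub>F n in sequentially. \<exists>Y\<in>V. (\<forall>i. Y $ i \<in> S (r n) i) \<and> (\<Sum>i\<in>UNIV. \<psi> n i (Y $ i)) \<le> det_cols Y + e"
      if "X \<in> \<Gamma>" "open V" "X \<in> V" "e > 0" for X V e
      using slack[OF that] unfolding psi_sum F_def by simp
  qed
  then obtain \<Phi> where \<Phi>: "\<forall>i. lower_semicontinuous (\<Phi> i)" "\<forall>i x. \<Phi> i x \<noteq> -\<infinity>"
    "\<forall>X. ereal (det_cols X) \<le> (\<Sum>i\<in>UNIV. \<Phi> i (X $ i))"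
    "\<forall>X\<in>\<Gamma>. (\<Sum>i\<in>UNIV. \<Phi> i (X $ i)) = ereal (det_cols X)" by (elim exE conjE)
  have "\<Phi> \<in> dual_admissible" using \<Phi> by (auto simp: dual_admissible_def)
  moreover have "AE X in \<gamma>. (\<Sum>i\<in>UNIV. \<Phi> i (X $ i)) = ereal (det_cols X)"
    using AE_\<Gamma> by eventually_elim (use \<Phi>(4) in blast)
  ultimately show ?thesis using \<gamma> by blast
qed

theorem theorem3p2:
  fixes \<mu> :: "'d::finite \<Rightarrow> (real ^ 'd) measure"
    and p :: "'d \<Rightarrow> real"
  assumes prob: "\<And>i. prob_space (\<mu> i)"
    and borel: "\<And>i. sets (\<mu> i) = sets borel"
    and p_gt: "\<And>i. p i > 1"
    and p_sum: "(\<Sum>i\<in>UNIV. 1 / p i) = 1"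
    and moments: "(\<Sum>i\<in>UNIV. \<integral>\<^sup>+ x. ennreal (norm x powr p i / p i) \<partial>(\<mu> i)) < \<infinity>"
  shows "\<exists>\<gamma> \<in> couplings \<mu>. \<exists>\<phi> \<in> dual_admissible.
           (\<forall>\<gamma>' \<in> couplings \<mu>. integral\<^sup>L \<gamma>' det_cols \<le> integral\<^sup>L \<gamma> det_cols) \<and>
           (\<forall>\<psi> \<in> dual_admissible. dual_value \<mu> \<phi> \<le> dual_value \<mu> \<psi>) \<and>
           ereal (integral\<^sup>L \<gamma> det_cols) = dual_value \<mu> \<phi> \<and>
           (\<forall>i x. \<phi> i x = (SUP X \<in> {X :: real ^ 'd ^ 'd. X $ i = x}.
                               ereal (det_cols X) - (\<Sum>j\<in>UNIV - {i}. \<phi> j (X $ j))))"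
proof -
  interpret determinant_transport \<mu> p
    by (intro determinant_transport.intro assms)
  obtain \<gamma> \<Phi> where \<gamma>: "\<gamma> \<in> couplings \<mu>" and \<Phi>: "\<Phi> \<in> dual_admissible"
    and eq: "AE X in \<gamma>. (\<Sum>i\<in>UNIV. \<Phi> i (X $ i)) = ereal (det_cols X)"
    using ex_coupling_potentials[where \<mu> = \<mu>, OF prob borel] by (elim bexE)
  interpret \<gamma>: prob_space \<gamma> using \<gamma> by (rule prob_space_coupling)
  \<comment> \<open>At a point of zero slack all potentials are finite, which conjugation needs in
    order to avoid -\<infinity>.\<close>
  obtain X0 where X0: "(\<Sum>i\<in>UNIV. \<Phi> i (X0 $ i)) = ereal (det_cols X0)"
    using eq \<gamma>.AE_contr by (metis (mono_tags, lifting) AE_mp AE_I2)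
  have "\<Phi> i (X0 $ i) < \<infinity>" for i
    using X0 sum_Pinfty[of "\<lambda>i. \<Phi> i (X0 $ i)" UNIV] by auto
  from ex_conjugate_potentials[OF \<Phi> this]
  obtain \<phi> where \<phi>: "\<phi> \<in> dual_admissible" and le: "\<forall>i x. \<phi> i x \<le> \<Phi> i x"
    and conj: "\<forall>i. \<phi> i = conj_potential \<phi> i" by (elim bexE conjE)
  have "AE X in \<gamma>. (\<Sum>i\<in>UNIV. \<phi> i (X $ i)) = ereal (det_cols X)"
    using eq
  proof eventually_elim
    case (elim X)
    have "(\<Sum>i\<in>UNIV. \<phi> i (X $ i)) \<le> (\<Sum>i\<in>UNIV. \<Phi> i (X $ i))"
      using le by (intro sum_mono) auto
    moreover have "ereal (det_cols X) \<le> (\<Sum>i\<in>UNIV. \<phi> i (X $ i))"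
      using \<phi> unfolding dual_admissible_def by blast
    ultimately show ?case using elim by (intro antisym) auto
  qed
  hence val: "dual_value \<mu> \<phi> = ereal (integral\<^sup>L \<gamma> det_cols)"
    by (rule complementary_slackness[OF \<gamma> \<phi>])
  show ?thesis
  proof (intro bexI[OF _ \<gamma>] bexI[OF _ \<phi>] conjI ballI allI)
    show "integral\<^sup>L \<gamma>' det_cols \<le> integral\<^sup>L \<gamma> det_cols" if "\<gamma>' \<in> couplings \<mu>" for \<gamma>'
      using weak_duality[OF that \<phi>] by (simp add: val)
    show "dual_value \<mu> \<phi> \<le> dual_value \<mu> \<psi>" if "\<psi> \<in> dual_admissible" for \<psi>
      using weak_duality[OF \<gamma> that] by (simp add: val)
    show "ereal (integral\<^sup>L \<gamma> det_cols) = dual_value \<mu> \<phi>" by (simp add: val)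
    show "\<phi> i x = (SUP X \<in> {X :: real ^ 'd ^ 'd. X $ i = x}.
        ereal (det_cols X) - (\<Sum>j\<in>UNIV - {i}. \<phi> j (X $ j)))" for i x
      using conj conj_potential_def[of \<phi> i x] by metis
  qed
qed

end
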